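(* Consider the constraint-coupled problem $$(P)\qquad \min_{x_1,\dots,x_N}\ \sum_{i=1}^N f_i(x_i)\quad\text{subject to}\quad \sum_{i=1}^N g_i(x_i)\le 0,\qquad x_i\in X_i,\ i=1,\dots,N,$$ where for every $i\in\{1,\dots,N\}$ the set $X_i\subset\mathbb{R}^{n_i}$ is non-empty, convex and compact, $f_i:\mathbb{R}^{n_i}\to\mathbb{R}$ is convex, and each component of $g_i:\mathbb{R}^{n_i}\to\mathbb{R}^S$ is convex. Assume there exist $\bar x_i\in X_i$, $i=1,\dots,N$, with $\sum_{i=1}^N g_i(\bar x_i)<0$ (componentwise). Let $f^\star$ be the optimal cost of (P), let $\mu^\star\in\mathbb{R}^S$ be an optimal Lagrange multiplier of (P) associated with the constraint $\sum_{i=1}^N g_i(x_i)\le 0$, and assume $M>\|\mu^\star\|_1$. Let the communication graphs $\mathcal{G}^t$, $t\ge0$, be random subgraphs of an undirected connected graph $\mathcal{G}_u$ on $\{1,\dots,N\}$, following the random edge-activation model described in the context. Let the step-sizes satisfy $\alpha^t\ge 0$, $\sum_{t=0}^\infty\alpha^t=\infty$ and $\sum_{t=0}^\infty(\alpha^t)^2<\infty$. Consider a sequence $\{(x_i^t,\rho_i^t)\}_{t\ge0}$, $i\in\{1,\dots,N\}$, generated by the DPD-TV algorithm (see context) with initial vectors $y_i^0\in\mathbb{R}^S$ such that $\sum_{i=1}^N y_i^0=0$. Then, almost surely: (i) $\sum_{i=1}^N\big(f_i(x_i^t)+M\rho_i^t\big)\to f^\star$ as $t\to\infty$; (ii) every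 limit point of $\{(x_1^t,\dots,x_N^t)\}_{t\ge0}$ is an optimal (feasible) solution of (P).
   Context: Vector inequalities are componentwise; $\mathbf 1$ denotes the vector of ones. Random communication model. $\mathcal{G}_u=(\{1,\dots,N\},\mathcal{E}_u)$ is an undirected connected graph, with $(i,j)\in\mathcal{E}_u$ iff $(j,i)\in\mathcal{E}_u$. Each undirected edge $(i,j)\in\mathcal{E}_u$ has a probability $\sigma_{ij}\in(0,1]$ of being active. For $(i,j)\in\mathcal{E}_u$ with $j>i$ and $t\ge0$, $\nu_{ij}^t$ is the Bernoulli random variable equal to $1$ if the edge is active at time $t$ and $0$ otherwise (so $\nu_{ij}^t=1$ with probability $\sigma_{ij}$). The set of active edges at time $t$ is $\mathcal{E}^t\subseteq\mathcal{E}_u$ (an active undirected edge contributes both $(i,j)$ and $(j,i)$), $\mathcal{G}^t=(\{1,\dots,N\},\mathcal{E}^t)$, and $\mathcal{N}_i^t=\{j : (i,j)\in\mathcal{E}^t\}$. Assumption: for each $(i,j)\in\mathcal{E}_u$ with $j>i$ the random variables $\{\nu_{ij}^t\}_{t\ge0}$ are independent and identically distributed; moreover, for each $t\ge0$ the random variables $\{\nu_{ij}^t\}_{(i,j)\in\mathcal{E}_u,\,j>i}$ are mutually independent. DPD-TV algorithm. Given $y_i^0$, for $t=0,1,2,\dots$ each $i\in\{1,\dots,N\}$: (1) computes $((x_i^t,\rho_i^t),\mu_i^t)$ as a primal-dual solution of $$\min_{x_i,\rho_i}\ f_i(x_i)+M\rho_i\quad\text{subject to}\quad g_i(x_i)\le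 y_i^t+\rho_i\mathbf 1,\quad x_i\in X_i,\ \rho_i\ge0,$$ where $\mu_i^t\in\mathbb{R}^S$ is the Lagrange multiplier associated with the constraint $g_i(x_i)\le y_i^t+\rho_i\mathbf 1$; (2) gathers $\mu_j^t$ from $j\in\mathcal{N}_i^t$ and updates $y_i^{t+1}=y_i^t+\alpha^t\sum_{j\in\mathcal{N}_i^t}(\mu_i^t-\mu_j^t)$.
   Formalization: Added assumption: the multipliers are random vectors, and for each t the edge activations at time t are independent of all earlier activations and of the multipliers computed up to time t; without it, choosing among non-unique multipliers with knowledge of future activations can break the claim. *)

theory Defs
  imports "HOL-Probability.Probability"
begin

section \<open>Convex programs with inequality constraints\<close>

text \<open>
  Generic program: minimise \<open>F z\<close> subject to \<open>G z \<le> 0\<close> and \<open>z \<in> Z\<close>.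
  The order on \<^typ>\<open>real ^ 's\<close> is componentwise.
\<close>

definition feasible :: "'z set \<Rightarrow> ('z \<Rightarrow> real ^ 's) \<Rightarrow> 'z set" where
  "feasible Z G = {z \<in> Z. G z \<le> 0}"

definition optimal_solution ::
  "('z \<Rightarrow> real) \<Rightarrow> 'z set \<Rightarrow> ('z \<Rightarrow> real ^ 's) \<Rightarrow> 'z \<Rightarrow> bool" where
  "optimal_solution F Z G z \<longleftrightarrow> is_arg_min F (\<lambda>z. z \<in> feasible Z G) z"

text \<open>
  A real infimum: only meaningful for a feasible program with cost bounded below.
\<close>

definition optimal_cost :: "('z \<Rightarrow> real) \<Rightarrow> 'z set \<Rightarrow> ('z \<Rightarrow> real ^ 's) \<Rightarrow> real" where
  "optimal_cost F Z G = (INF z\<in>feasible Z G. F z)"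

text \<open>
  The dual function is extended-real valued because it may be \<open>-\<infinity>\<close> when \<open>Z\<close> is unbounded
  (as in the local programs below).  An optimal Lagrange multiplier is a solution of the
  dual program: maximise the dual function over \<open>\<mu> \<ge> 0\<close>.
\<close>

definition dual_function ::
  "('z \<Rightarrow> real) \<Rightarrow> 'z set \<Rightarrow> ('z \<Rightarrow> real ^ 's) \<Rightarrow> real ^ 's \<Rightarrow> ereal" where
  "dual_function F Z G \<mu> = (INF z\<in>Z. ereal (F z + \<mu> \<bullet> G z))"

definition optimal_multiplier ::
  "('z \<Rightarrow> real) \<Rightarrow> 'z set \<Rightarrow> ('z \<Rightarrow> real ^ 's) \<Rightarrow> real ^ 's \<Rightarrow> bool" where
  "optimal_multiplier F Z G \<mu> \<longleftrightarrow> is_arg_max (dual_function F Z G) (\<lambda>\<mu>. 0 \<le> \<mu>) \<mu>"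

definition primal_dual_solution ::
  "('z \<Rightarrow> real) \<Rightarrow> 'z set \<Rightarrow> ('z \<Rightarrow> real ^ 's) \<Rightarrow> 'z \<Rightarrow> real ^ 's \<Rightarrow> bool" where
  "primal_dual_solution F Z G z \<mu> \<longleftrightarrow> optimal_solution F Z G z \<and> optimal_multiplier F Z G \<mu>"

definition norm_1 :: "real ^ 's \<Rightarrow> real" where
  "norm_1 \<mu> = (\<Sum>s\<in>UNIV. \<bar>\<mu> $ s\<bar>)"


section \<open>The constraint-coupled problem\<close>

text \<open>
  Agents are the elements of a finite linearly ordered type \<open>'n\<close>, standing for \<open>{1,\<dots>,N}\<close>.
  The local dimensions \<open>n\<^sub>i\<close> may differ between agents, so the space of agent \<open>i\<close> is
  represented as \<open>coord_space (J i)\<close> with \<open>n\<^sub>i = card (J i)\<close>, the vectors of a common ambient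
  space \<^typ>\<open>real ^ 'd\<close> that vanish outside the coordinates \<open>J i\<close>.
\<close>

definition coord_space :: "'d set \<Rightarrow> (real ^ 'd) set" where
  "coord_space J = {x. \<forall>k. k \<notin> J \<longrightarrow> x $ k = 0}"

definition total_cost :: "('n::finite \<Rightarrow> real ^ 'd \<Rightarrow> real) \<Rightarrow> (real ^ 'd) ^ 'n \<Rightarrow> real" where
  "total_cost f x = (\<Sum>i\<in>UNIV. f i (x $ i))"

definition coupling ::
  "('n::finite \<Rightarrow> real ^ 'd \<Rightarrow> real ^ 's) \<Rightarrow> (real ^ 'd) ^ 'n \<Rightarrow> real ^ 's" where
  "coupling g x = (\<Sum>i\<in>UNIV. g i (x $ i))"

definition local_sets :: "('n::finite \<Rightarrow> (real ^ 'd) set) \<Rightarrow> ((real ^ 'd) ^ 'n) set" where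
  "local_sets X = {x. \<forall>i. x $ i \<in> X i}"


section \<open>Random communication graphs\<close>

text \<open>
  Edge activations are indexed by the pairs \<open>(i, j) \<in> E\<close> with \<open>i < j\<close>;
  \<open>\<nu> i j t \<omega>\<close> tells whether the undirected edge \<open>{i, j}\<close> is active at time \<open>t\<close>.
\<close>

definition undirected_connected :: "('n \<times> 'n) set \<Rightarrow> bool" where
  "undirected_connected E \<longleftrightarrow> sym E \<and> (\<forall>i j. (i, j) \<in> E\<^sup>*)"

definition up_edges :: "('n::linorder \<times> 'n) set \<Rightarrow> ('n \<times> 'n) set" where
  "up_edges E = {(i, j) \<in> E. i < j}"

definition active_edges ::
  "('n::linorder \<times> 'n) set \<Rightarrow> ('n \<Rightarrow> 'n \<Rightarrow> nat \<Rightarrow> 'w \<Rightarrow> bool) \<Rightarrow> 'w \<Rightarrow> nat \<Rightarrow> ('n \<times> 'n) set" where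
  "active_edges E \<nu> \<omega> t =
     (let A = {(i, j) \<in> up_edges E. \<nu> i j t \<omega>} in A \<union> A\<inverse>)"

text \<open>
  Independence of the random variables includes their measurability.
  Identical distribution over time is the fact that \<open>\<sigma> i j\<close> does not depend on \<open>t\<close>.
\<close>

definition random_activation ::
  "'w measure \<Rightarrow> ('n::linorder \<times> 'n) set \<Rightarrow> ('n \<Rightarrow> 'n \<Rightarrow> real)
     \<Rightarrow> ('n \<Rightarrow> 'n \<Rightarrow> nat \<Rightarrow> 'w \<Rightarrow> bool) \<Rightarrow> bool" where
  "random_activation P E \<sigma> \<nu> \<longleftrightarrow>
     (\<forall>(i, j) \<in> up_edges E. 0 < \<sigma> i j \<and> \<sigma> i j \<le> 1) \<and>
     (\<forall>(i, j) \<in> up_edges E. \<forall>t.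
        distr P (count_space UNIV) (\<nu> i j t) = measure_pmf (bernoulli_pmf (\<sigma> i j))) \<and>
     (\<forall>(i, j) \<in> up_edges E.
        prob_space.indep_vars P (\<lambda>_. count_space UNIV) (\<lambda>t. \<nu> i j t) UNIV) \<and>
     (\<forall>t. prob_space.indep_vars P (\<lambda>_. count_space UNIV) (\<lambda>(i, j). \<nu> i j t) (up_edges E))"

text \<open>
  The sigma-algebra of everything that has happened before the activations of time \<open>t\<close> are
  drawn: earlier activations and the multipliers computed up to and including time \<open>t\<close>.
  For a fixed initialisation, these determine the vectors \<open>y\<^sub>i\<close> up to time \<open>t\<close>.
\<close>

definition history ::
  "'w measure \<Rightarrow> ('n::linorder \<times> 'n) set \<Rightarrow> ('n \<Rightarrow> 'n \<Rightarrow> nat \<Rightarrow> 'w \<Rightarrow> bool)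
     \<Rightarrow> ('n \<Rightarrow> nat \<Rightarrow> 'w \<Rightarrow> real ^ 's) \<Rightarrow> nat \<Rightarrow> 'w set set" where
  "history P E \<nu> \<mu> t = sigma_sets (space P)
     ({\<nu> i j s -` A \<inter> space P | i j s A. (i, j) \<in> up_edges E \<and> s < t} \<union>
      {\<mu> i s -` A \<inter> space P | i s A. s \<le> t \<and> A \<in> sets borel})"

definition current_activations ::
  "'w measure \<Rightarrow> ('n::linorder \<times> 'n) set \<Rightarrow> ('n \<Rightarrow> 'n \<Rightarrow> nat \<Rightarrow> 'w \<Rightarrow> bool)
     \<Rightarrow> nat \<Rightarrow> 'w set set" where
  "current_activations P E \<nu> t = sigma_sets (space P)
     {\<nu> i j t -` A \<inter> space P | i j A. (i, j) \<in> up_edges E}"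

text \<open>
  The algorithm runs forward in time: the edges active at time \<open>t\<close> are drawn independently of
  the past, in particular after and independently of the choice, among possibly many
  primal-dual solutions, of the multipliers of time \<open>t\<close>.  As \<^const>\<open>prob_space.indep_set\<close>
  requires both families to consist of events, the multipliers are random vectors.
\<close>

definition nonanticipating ::
  "'w measure \<Rightarrow> ('n::linorder \<times> 'n) set \<Rightarrow> ('n \<Rightarrow> 'n \<Rightarrow> nat \<Rightarrow> 'w \<Rightarrow> bool)
     \<Rightarrow> ('n \<Rightarrow> nat \<Rightarrow> 'w \<Rightarrow> real ^ 's) \<Rightarrow> bool" where
  "nonanticipating P E \<nu> \<mu> \<longleftrightarrow>
     (\<forall>t. prob_space.indep_set P (history P E \<nu> \<mu> t) (current_activations P E \<nu> t))"


section \<open>The DPD-TV algorithm\<close>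

text \<open>
  The local program of agent \<open>i\<close> in the pair \<open>(x, \<rho>)\<close>, with the constraint
  \<open>g x \<le> y + \<rho> 1\<close> written as \<open>g x - y - \<rho> 1 \<le> 0\<close>.  In \<^typ>\<open>real ^ 's\<close>, \<open>1\<close> is the vector of ones.
\<close>

definition local_solution ::
  "real \<Rightarrow> (real ^ 'd \<Rightarrow> real) \<Rightarrow> (real ^ 'd \<Rightarrow> real ^ 's) \<Rightarrow> (real ^ 'd) set \<Rightarrow> real ^ 's
     \<Rightarrow> real ^ 'd \<Rightarrow> real \<Rightarrow> real ^ 's \<Rightarrow> bool" where
  "local_solution M f g X y x \<rho> \<mu> \<longleftrightarrow>
     primal_dual_solution (\<lambda>(x, \<rho>). f x + M * \<rho>) (X \<times> {0..})
       (\<lambda>(x, \<rho>). g x - y - \<rho> *\<^sub>R 1) (x, \<rho>) \<mu>"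

text \<open>A run along one realisation \<open>EE t\<close> of the active edge sets.\<close>

definition dpd_tv ::
  "real \<Rightarrow> ('n::finite \<Rightarrow> real ^ 'd \<Rightarrow> real) \<Rightarrow> ('n \<Rightarrow> real ^ 'd \<Rightarrow> real ^ 's)
     \<Rightarrow> ('n \<Rightarrow> (real ^ 'd) set) \<Rightarrow> (nat \<Rightarrow> real) \<Rightarrow> (nat \<Rightarrow> ('n \<times> 'n) set) \<Rightarrow> ('n \<Rightarrow> real ^ 's)
     \<Rightarrow> ('n \<Rightarrow> nat \<Rightarrow> real ^ 's) \<Rightarrow> ('n \<Rightarrow> nat \<Rightarrow> real ^ 'd) \<Rightarrow> ('n \<Rightarrow> nat \<Rightarrow> real)
     \<Rightarrow> ('n \<Rightarrow> nat \<Rightarrow> real ^ 's) \<Rightarrow> bool" where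
  "dpd_tv M f g X \<alpha> EE y0 y x \<rho> \<mu> \<longleftrightarrow>
     (\<forall>i. y i 0 = y0 i) \<and>
     (\<forall>i t. local_solution M (f i) (g i) (X i) (y i t) (x i t) (\<rho> i t) (\<mu> i t)) \<and>
     (\<forall>i t. y i (Suc t) = y i t + \<alpha> t *\<^sub>R (\<Sum>j\<in>{j. (i, j) \<in> EE t}. \<mu> i t - \<mu> j t))"

definition limit_point :: "(nat \<Rightarrow> 'z::topological_space) \<Rightarrow> 'z \<Rightarrow> bool" where
  "limit_point u l \<longleftrightarrow> (\<exists>r :: nat \<Rightarrow> nat. strict_mono r \<and> (u \<circ> r) \<longlonglongrightarrow> l)"

end

theory Submission
  imports Defs
begin

text \<open>
  By Slater's condition strong duality holds, so each multiplier \<open>\<mu> i t\<close> is bounded by \<open>M\<close> and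
  \<open>- \<mu> i t\<close> is a subgradient at \<open>y i t\<close> of the optimal value of the local program.  The vectors
  \<open>y i t\<close> are the divergence of a flow on the edges, and in the flow variables the algorithm is a
  randomised subgradient method whose step on edge \<open>e\<close> is taken with probability \<open>\<sigma> e\<close>.
  Connectedness provides a flow \<open>z\<^sup>*\<close> reaching an optimal allocation.  The expectation of
  \<open>\<Sum>e. |z e - z\<^sup>* e|\<^sup>2 / \<sigma> e\<close> decreases by at least \<open>2 \<alpha> t\<close> times the expected suboptimality
  gap, up to a summable error, so \<open>\<Sum>t. \<alpha> t * gap t\<close> has finite expectation and is finite almost
  surely.  As the gap changes by \<open>O(\<alpha> t)\<close> per step,
  its square has summable increments, and the gap tends to \<open>0\<close>.
\<close>

section \<open>Strong duality\<close>

text \<open>A negative slope would drive the right-hand side below any bound. The lemma extracts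
  sign conditions on multipliers by letting one variable run to infinity.\<close>

lemma nonneg_if_affine_bounded_below:
  fixes a b c :: real
  assumes "\<And>k. 0 \<le> k \<Longrightarrow> b \<le> c + k * a"
  shows "0 \<le> a"
proof (rule ccontr)
  assume "\<not> 0 \<le> a"
  then have a: "a < 0" by simp
  define k where "k = (\<bar>c - b\<bar> + 1) / (- a)"
  have "0 \<le> k" using a by (simp add: k_def divide_nonneg_neg)
  moreover have "k * a = - (\<bar>c - b\<bar> + 1)" using a by (simp add: k_def)
  ultimately show False using assms[of k] by linarith
qed

lemma inner_mono_nonneg_vec:
  fixes m u v :: "real ^ 's"
  assumes "0 \<le> m" "u \<le> v"
  shows "m \<bullet> u \<le> m \<bullet> v"
  using assms unfolding inner_vec_def less_eq_vec_def
  by (intro sum_mono) (simp add: mult_left_mono)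

text \<open>Separate the achievable pairs of constraint bound and cost bound from the ray with zero
  constraint and cost below \<open>v\<close>. The normal of the hyperplane, scaled to cost component
  1, gives the multiplier; Slater's condition keeps the hyperplane from being vertical.\<close>

lemma Slater_multiplier_exists:
  fixes F :: "'z::real_vector \<Rightarrow> real" and G :: "'z \<Rightarrow> real ^ 's::finite"
  assumes F: "convex_on Z F" and G: "\<And>s. convex_on Z (\<lambda>z. G z $ s)"
    and slater: "z1 \<in> Z" "\<And>s. G z1 $ s < 0"
    and lower: "\<And>z. z \<in> feasible Z G \<Longrightarrow> v \<le> F z"
  shows "\<exists>\<mu>. 0 \<le> \<mu> \<and> (\<forall>z\<in>Z. v \<le> F z + \<mu> \<bullet> G z)"
proof -
  define S where "S = {(u, r). \<exists>z\<in>Z. G z \<le> u \<and> F z \<le> r}"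
  define T where "T = ({0} :: (real ^ 's) set) \<times> {..<v}"
  have SI: "(u, r) \<in> S" if "z \<in> Z" "G z \<le> u" "F z \<le> r" for z u r
    using that by (auto simp: S_def)
  have "convex S"
  proof (rule convexI)
    fix p q and a b :: real
    assume p: "p \<in> S" and q: "q \<in> S" and ab: "0 \<le> a" "0 \<le> b" "a + b = 1"
    obtain u r z where pz: "p = (u, r)" "z \<in> Z" "G z \<le> u" "F z \<le> r"
      using p by (auto simp: S_def)
    obtain u' r' z' where qz: "q = (u', r')" "z' \<in> Z" "G z' \<le> u'" "F z' \<le> r'"
      using q by (auto simp: S_def)
    let ?w = "a *\<^sub>R z + b *\<^sub>R z'"
    have "?w \<in> Z"
      using F pz qz ab by (auto simp: convex_on_def intro: convexD)
    moreover have "F ?w \<le> a * r + b * r'"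
    proof -
      have "F ?w \<le> a * F z + b * F z'"
        using F pz qz ab by (auto simp: convex_on_def)
      also have "\<dots> \<le> a * r + b * r'"
        using pz qz ab by (intro add_mono mult_left_mono) auto
      finally show ?thesis .
    qed
    moreover have "G ?w \<le> a *\<^sub>R u + b *\<^sub>R u'"
      unfolding less_eq_vec_def
    proof
      fix s
      have "G ?w $ s \<le> a * G z $ s + b * G z' $ s"
        using G[of s] pz qz ab by (auto simp: convex_on_def)
      also have "\<dots> \<le> a * u $ s + b * u' $ s"
        using pz qz ab by (intro add_mono mult_left_mono) (auto simp: less_eq_vec_def)
      finally show "G ?w $ s \<le> (a *\<^sub>R u + b *\<^sub>R u') $ s" by simp
    qed
    ultimately show "a *\<^sub>R p + b *\<^sub>R q \<in> S"
      using SI[of ?w] pz(1) qz(1) by simp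
  qed
  moreover have "convex T"
    unfolding T_def by (intro convex_Times) auto
  moreover have "T \<noteq> {}"
    by (auto simp: T_def intro: exI[of _ "v - 1"])
  moreover have "S \<noteq> {}" using SI[OF slater(1) order_refl order_refl] by blast
  moreover have "T \<inter> S = {}"
    using lower by (fastforce simp: S_def T_def feasible_def)
  ultimately obtain a b where "a \<noteq> 0" and
    ab: "\<forall>p\<in>T. a \<bullet> p \<le> b" "\<forall>p\<in>S. b \<le> a \<bullet> p"
    using separating_hyperplane_sets[of T S] by metis
  obtain m c where a: "a = (m, c)" by force
  have T: "c * r \<le> b" if "r < v" for r
    using bspec[OF ab(1), of "(0, r)"] that by (simp add: T_def a)
  have S: "b \<le> m \<bullet> u + c * r" if "z \<in> Z" "G z \<le> u" "F z \<le> r" for z u r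
    using bspec[OF ab(2), of "(u, r)"] that SI[of z u r] by (simp add: a)
  \<comment> \<open>\<open>S\<close> is upward closed, so the constraint bound may be raised along
    any axis, and likewise the cost bound, without leaving \<open>S\<close>.\<close>
  have m: "0 \<le> m $ s" for s
  proof (rule nonneg_if_affine_bounded_below)
    fix k :: real assume k: "0 \<le> k"
    have "b \<le> m \<bullet> (G z1 + k *\<^sub>R axis s 1) + c * F z1"
      by (rule S[OF slater(1)]) (use k in \<open>auto simp: less_eq_vec_def axis_def\<close>)
    then show "b \<le> (m \<bullet> G z1 + c * F z1) + k * m $ s"
      by (simp add: inner_add_right inner_axis algebra_simps)
  qed
  have c: "0 \<le> c"
  proof (rule nonneg_if_affine_bounded_below)
    fix k :: real assume k: "0 \<le> k"
    have "b \<le> m \<bullet> G z1 + c * (F z1 + k)"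
      by (rule S[OF slater(1)]) (use k in auto)
    then show "b \<le> (m \<bullet> G z1 + c * F z1) + k * c" by (simp add: algebra_simps)
  qed
  \<comment> \<open>\<open>T\<close> only contains costs strictly below \<open>v\<close>, so for
    \<open>c > 0\<close> the bound at \<open>v\<close> itself is a limit; for \<open>c = 0\<close>
    any point of \<open>T\<close> gives it.\<close>
  have cv: "c * v \<le> b"
  proof (cases "c = 0")
    case True
    then show ?thesis using T[of "v - 1"] by simp
  next
    case False
    with c have c: "0 < c" by simp
    show ?thesis
    proof (rule field_le_epsilon)
      fix e :: real assume "0 < e"
      then have "c * (v - e / c) \<le> b" using T[of "v - e / c"] c by simp
      then show "c * v \<le> b + e" using c by (simp add: right_diff_distrib)
    qed
  qed
  \<comment> \<open>A vertical hyperplane would have a nonzero \<open>m\<close> with nonnegative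
    entries, making \<open>m \<bullet> G z1\<close> negative at the Slater point, whereas
    \<open>b\<close> is then at least 0 and bounds it from below.\<close>
  have "c \<noteq> 0"
  proof
    assume "c = 0"
    then have "m \<noteq> 0" using \<open>a \<noteq> 0\<close> a by (auto simp: zero_prod_def)
    then obtain s where "m $ s \<noteq> 0" by (auto simp: vec_eq_iff)
    with m[of s] have "0 < m $ s" by simp
    then have "m $ s * G z1 $ s < 0" using slater(2)[of s] by (rule mult_pos_neg)
    moreover have "m $ s * G z1 $ s \<le> 0" for s
      using m[of s] slater(2)[of s] by (simp add: mult_nonneg_nonpos)
    ultimately have "(\<Sum>s\<in>UNIV. m $ s * G z1 $ s) < (\<Sum>s\<in>(UNIV :: 's set). 0)"
      by (intro sum_strict_mono_ex1) auto
    then have "m \<bullet> G z1 < 0" by (simp add: inner_vec_def)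
    moreover have "0 \<le> m \<bullet> G z1"
      using S[OF slater(1) order_refl order_refl] cv \<open>c = 0\<close> by simp
    ultimately show False by simp
  qed
  with c have c: "0 < c" by simp
  show ?thesis
  proof (intro exI conjI ballI)
    show "0 \<le> (1 / c) *\<^sub>R m" using m c by (simp add: less_eq_vec_def)
    fix z assume "z \<in> Z"
    then have "c * v \<le> m \<bullet> G z + c * F z" using cv S[OF _ order_refl order_refl] by fastforce
    then show "v \<le> F z + ((1 / c) *\<^sub>R m) \<bullet> G z"
      using c by (simp add: field_simps)
  qed
qed

text \<open>The Slater multiplier has dual value at least \<open>v\<close>, and a dual maximiser
  does no worse. Here \<open>v\<close> may be any lower bound on the feasible costs; it becomes the
  optimal cost of a local program or of the coupled problem.\<close>

lemma optimal_multiplier_strong_duality: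
  fixes F :: "'z::real_vector \<Rightarrow> real" and G :: "'z \<Rightarrow> real ^ 's::finite"
  assumes "convex_on Z F" and "\<And>s. convex_on Z (\<lambda>z. G z $ s)"
    and "z1 \<in> Z" "\<And>s. G z1 $ s < 0"
    and lower: "\<And>z. z \<in> feasible Z G \<Longrightarrow> v \<le> F z"
    and opt: "optimal_multiplier F Z G \<mu>"
  shows "0 \<le> \<mu>" and "z \<in> Z \<Longrightarrow> v \<le> F z + \<mu> \<bullet> G z"
proof -
  obtain m where m: "0 \<le> m" "\<forall>z\<in>Z. v \<le> F z + m \<bullet> G z"
    using Slater_multiplier_exists[OF assms(1-5)] by blast
  show "0 \<le> \<mu>" using opt by (simp add: optimal_multiplier_def is_arg_max_def)
  have "ereal v \<le> dual_function F Z G m"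
    unfolding dual_function_def using m(2) by (intro INF_greatest) simp
  also have "\<dots> \<le> dual_function F Z G \<mu>"
    using opt m(1) by (auto simp: optimal_multiplier_def is_arg_max_def not_less)
  finally have "ereal v \<le> dual_function F Z G \<mu>" .
  then show "v \<le> F z + \<mu> \<bullet> G z" if "z \<in> Z"
    using that unfolding dual_function_def le_INF_iff by auto
qed

section \<open>Multipliers of the local programs\<close>

lemma norm_le_norm_1: "norm \<mu> \<le> norm_1 \<mu>"
  unfolding norm_1_def by (rule norm_le_l1_cart)

lemma norm_1_nonneg_eq: "0 \<le> \<mu> \<Longrightarrow> norm_1 \<mu> = \<mu> \<bullet> 1"
  by (simp add: norm_1_def inner_vec_def less_eq_vec_def)

text \<open>The last claim says that \<open>- \<mu>\<close> is a subgradient at \<open>y\<close> of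
  the optimal value of the local program, phrased through an arbitrary competitor feasible for
  \<open>y'\<close>. The bound by \<open>M\<close> comes from the relaxation variable: its cost
  slope \<open>M\<close> must dominate the sum of the entries of \<open>\<mu>\<close>.\<close>

lemma local_solution_multiplier:
  fixes f :: "real ^ 'd \<Rightarrow> real" and g :: "real ^ 'd \<Rightarrow> real ^ 's::finite"
  assumes f: "convex_on X f" and g: "\<And>s. convex_on X (\<lambda>x. g x $ s)"
    and sol: "local_solution M f g X y x \<rho> \<mu>"
  shows "x \<in> X" "0 \<le> \<rho>" "g x \<le> y + \<rho> *\<^sub>R 1" "norm \<mu> \<le> M"
    and "\<lbrakk>x' \<in> X; 0 \<le> \<rho>'; g x' \<le> y' + \<rho>' *\<^sub>R 1\<rbrakk>
      \<Longrightarrow> f x + M * \<rho> - \<mu> \<bullet> (y' - y) \<le> f x' + M * \<rho>'"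
proof -
  define F where "F = (\<lambda>(x, \<rho>). f x + M * \<rho>)"
  define G where "G = (\<lambda>(x, \<rho>). g x - y - \<rho> *\<^sub>R (1 :: real ^ 's))"
  define Z where "Z = X \<times> {0::real..}"
  have opt: "optimal_solution F Z G (x, \<rho>)" and mult: "optimal_multiplier F Z G \<mu>"
    using sol by (simp_all add: local_solution_def primal_dual_solution_def F_def G_def Z_def)
  have x: "(x, \<rho>) \<in> feasible Z G" and
    lower: "\<And>z. z \<in> feasible Z G \<Longrightarrow> F (x, \<rho>) \<le> F z"
    using opt by (auto simp: optimal_solution_def is_arg_min_def not_less)
  show xX: "x \<in> X" and \<rho>: "0 \<le> \<rho>" using x by (auto simp: feasible_def Z_def)
  show "g x \<le> y + \<rho> *\<^sub>R 1"
    using x by (auto simp: feasible_def G_def less_eq_vec_def algebra_simps)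
  have cZ: "convex Z" unfolding Z_def using f by (intro convex_Times) (auto simp: convex_on_def)
  have cF: "convex_on Z F"
    unfolding convex_on_def
  proof (intro conjI cZ ballI allI impI, unfold Z_def, clarify)
    fix x x' and r r' u v :: real
    assume *: "x \<in> X" "x' \<in> X" "0 \<le> u" "0 \<le> v" "u + v = 1"
    then have "f (u *\<^sub>R x + v *\<^sub>R x') \<le> u * f x + v * f x'"
      using f by (auto simp: convex_on_def)
    then show "F (u *\<^sub>R (x, r) + v *\<^sub>R (x', r')) \<le> u * F (x, r) + v * F (x', r')"
      by (simp add: F_def algebra_simps)
  qed
  have cG: "convex_on Z (\<lambda>z. G z $ s)" for s
    unfolding convex_on_def
  proof (intro conjI cZ ballI allI impI, unfold Z_def, clarify)
    fix x x' and r r' u v :: real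
    assume *: "x \<in> X" "x' \<in> X" "0 \<le> u" "0 \<le> v" "u + v = 1"
    then have "g (u *\<^sub>R x + v *\<^sub>R x') $ s \<le> u * g x $ s + v * g x' $ s"
      using g[of s] by (auto simp: convex_on_def)
    moreover have "y $ s = u * y $ s + v * y $ s"
      using *(5) by (metis distrib_right mult_1)
    ultimately show "G (u *\<^sub>R (x, r) + v *\<^sub>R (x', r')) $ s \<le> u * G (x, r) $ s + v * G (x', r') $ s"
      by (simp add: G_def algebra_simps)
  qed
  \<comment> \<open>A relaxation exceeding every residual of the solution is strictly feasible, so
    the local program satisfies Slater's condition whatever \<open>y\<close> is.\<close>
  define r1 where "r1 = 1 + (\<Sum>s\<in>UNIV. \<bar>g x $ s - y $ s\<bar>)"
  have r1: "g x $ s - y $ s < r1" for s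
    using member_le_sum[of s UNIV "\<lambda>s. \<bar>g x $ s - y $ s\<bar>"] unfolding r1_def by simp
  have "0 \<le> r1" unfolding r1_def by (intro add_nonneg_nonneg sum_nonneg) auto
  then have sl: "(x, r1) \<in> Z" "G (x, r1) $ s < 0" for s
    using xX r1[of s] by (auto simp: Z_def G_def)
  note sd = optimal_multiplier_strong_duality[OF cF cG sl lower mult]
  have mu: "0 \<le> \<mu>" by (rule sd(1))
  have dual: "f x + M * \<rho> \<le> f x' + M * \<rho>' + \<mu> \<bullet> (g x' - y - \<rho>' *\<^sub>R 1)"
    if "x' \<in> X" "0 \<le> \<rho>'" for x' \<rho>'
    using sd(2)[of "(x', \<rho>')"] that by (simp add: Z_def F_def G_def)
  \<comment> \<open>With \<open>x\<close> fixed and the relaxation \<open>k\<close> growing, the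
    Lagrangian stays bounded below only if its slope in \<open>k\<close> is nonnegative.\<close>
  have "0 \<le> M - \<mu> \<bullet> 1"
  proof (rule nonneg_if_affine_bounded_below)
    fix k :: real assume "0 \<le> k"
    then show "f x + M * \<rho> \<le> (f x + \<mu> \<bullet> (g x - y)) + k * (M - \<mu> \<bullet> 1)"
      using dual[OF xX, of k] by (simp add: algebra_simps inner_diff_right)
  qed
  then show "norm \<mu> \<le> M"
    using norm_le_norm_1[of \<mu>] norm_1_nonneg_eq[OF mu] by simp
  assume x': "x' \<in> X" "0 \<le> \<rho>'" "g x' \<le> y' + \<rho>' *\<^sub>R 1"
  have "g x' - y - \<rho>' *\<^sub>R 1 \<le> y' - y"
    using x'(3) by (auto simp: less_eq_vec_def algebra_simps)
  then have "\<mu> \<bullet> (g x' - y - \<rho>' *\<^sub>R 1) \<le> \<mu> \<bullet> (y' - y)"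
    by (rule inner_mono_nonneg_vec[OF mu])
  then show "f x + M * \<rho> - \<mu> \<bullet> (y' - y) \<le> f x' + M * \<rho>'"
    using dual[OF x'(1,2)] by simp
qed

section \<open>Weighted summability, flows and continuity\<close>

text \<open>Weighted summability against divergent steps makes \<open>a\<close> small infinitely
  often; the step bound rules out oscillation. The squares \<open>(a t)\<^sup>2\<close> have
  absolutely summable increments, hence converge, and a positive limit would make the steps
  summable.\<close>

lemma tendsto_0_if_weighted_summable:
  fixes a \<alpha> :: "nat \<Rightarrow> real"
  assumes a: "\<And>t. 0 \<le> a t" and \<alpha>: "\<And>t. 0 \<le> \<alpha> t"
    and div: "filterlim (\<lambda>n. \<Sum>t<n. \<alpha> t) at_top sequentially"
    and sq: "summable (\<lambda>t. (\<alpha> t)\<^sup>2)"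
    and wsum: "summable (\<lambda>t. \<alpha> t * a t)"
    and step: "\<And>t. \<bar>a (Suc t) - a t\<bar> \<le> C * \<alpha> t"
  shows "a \<longlonglongrightarrow> 0"
proof -
  have "summable (\<lambda>t. (a (Suc t))\<^sup>2 - (a t)\<^sup>2)"
  proof (rule summable_comparison_test')
    show "summable (\<lambda>t. 2 * C * (\<alpha> t * a t) + C\<^sup>2 * (\<alpha> t)\<^sup>2)"
      by (intro summable_add summable_mult wsum sq)
    fix t
    have C: "0 \<le> C * \<alpha> t" using step[of t] by linarith
    have "norm ((a (Suc t))\<^sup>2 - (a t)\<^sup>2) = \<bar>a (Suc t) - a t\<bar> * (a (Suc t) + a t)"
      using a by (simp add: power2_eq_square square_diff_square_factored abs_mult mult.commute)
    also have "\<dots> \<le> (C * \<alpha> t) * (2 * a t + C * \<alpha> t)"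
      using step[of t] a C by (intro mult_mono) (auto simp: add_nonneg_nonneg)
    finally show "norm ((a (Suc t))\<^sup>2 - (a t)\<^sup>2) \<le> 2 * C * (\<alpha> t * a t) + C\<^sup>2 * (\<alpha> t)\<^sup>2"
      by (simp add: algebra_simps power2_eq_square)
  qed
  then obtain D where "(\<lambda>n. \<Sum>t<n. (a (Suc t))\<^sup>2 - (a t)\<^sup>2) \<longlonglongrightarrow> D"
    by (auto simp: summable_def sums_def)
  then have "(\<lambda>n. (a n)\<^sup>2 - (a 0)\<^sup>2) \<longlonglongrightarrow> D"
    using sum_lessThan_telescope[of "\<lambda>t. (a t)\<^sup>2"] by simp
  then have "(\<lambda>n. (a n)\<^sup>2 - (a 0)\<^sup>2 + (a 0)\<^sup>2) \<longlonglongrightarrow> D + (a 0)\<^sup>2"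
    by (intro tendsto_intros)
  then obtain L where L: "(\<lambda>n. (a n)\<^sup>2) \<longlonglongrightarrow> L" by auto
  have "0 \<le> L" by (rule LIMSEQ_le_const[OF L]) auto
  have "\<not> 0 < L"
  proof
    assume "0 < L"
    then have "eventually (\<lambda>n. L / 2 < (a n)\<^sup>2) sequentially"
      using order_tendstoD(1)[OF L, of "L / 2"] by simp
    then have ev: "eventually (\<lambda>n. sqrt (L / 2) \<le> a n) sequentially"
      by eventually_elim (intro real_le_lsqrt, use a in auto)
    have "summable (\<lambda>t. sqrt (L / 2) * \<alpha> t)"
    proof (rule summable_comparison_test_ev[OF _ wsum])
      show "eventually (\<lambda>t. norm (sqrt (L / 2) * \<alpha> t) \<le> \<alpha> t * a t) sequentially"
        using ev by eventually_elim
          (use \<alpha> \<open>0 < L\<close> in \<open>auto simp: abs_mult mult.commute intro!: mult_left_mono\<close>)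
    qed
    then have "summable \<alpha>" using \<open>0 < L\<close> by (simp add: summable_mult_D)
    then have "(\<lambda>n. \<Sum>t<n. \<alpha> t) \<longlonglongrightarrow> suminf \<alpha>" by (rule summable_LIMSEQ)
    with div show False
      using not_tendsto_and_filterlim_at_infinity[OF sequentially_bot]
        filterlim_at_top_imp_at_infinity by blast
  qed
  with \<open>0 \<le> L\<close> L have "(\<lambda>n. (a n)\<^sup>2) \<longlonglongrightarrow> 0" by simp
  then have "(\<lambda>n. sqrt ((a n)\<^sup>2)) \<longlonglongrightarrow> sqrt 0" by (rule tendsto_real_sqrt)
  then show ?thesis using a by simp
qed

section \<open>Flows on the edges of a graph\<close>

text \<open>Summation by parts on the graph: every edge of \<open>A\<close> is met from both
  endpoints, and the two contributions combine into one product of differences. Testing with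
  arbitrary \<open>w\<close> turns a vector identity at the nodes into a scalar one on the
  edges.\<close>

lemma Laplacian_weak_form:
  fixes w m :: "'n::{finite,linorder} \<Rightarrow> 'v::real_inner"
  assumes A: "A \<subseteq> up_edges E"
  shows "(\<Sum>i\<in>UNIV. w i \<bullet> (\<Sum>j\<in>{j. (i, j) \<in> A \<union> A\<inverse>}. m i - m j))
    = (\<Sum>e\<in>A. (w (fst e) - w (snd e)) \<bullet> (m (fst e) - m (snd e)))"
proof -
  have "i < j" if "(i, j) \<in> A" for i j using A that by (auto simp: up_edges_def)
  \<comment> \<open>Edges of \<open>A\<close> point upwards in the order, so \<open>A\<close> and
    its converse share no pair and the sum splits.\<close>
  then have disj: "A \<inter> A\<inverse> = {}" using order.asym by blast
  let ?h = "\<lambda>e. w (fst e) \<bullet> (m (fst e) - m (snd e))"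
  have "(\<Sum>i\<in>UNIV. w i \<bullet> (\<Sum>j\<in>{j. (i, j) \<in> A \<union> A\<inverse>}. m i - m j))
      = (\<Sum>i\<in>UNIV. \<Sum>j\<in>{j. (i, j) \<in> A \<union> A\<inverse>}. ?h (i, j))"
    by (simp add: inner_sum_right)
  also have "\<dots> = (\<Sum>e\<in>(SIGMA i:UNIV. {j. (i, j) \<in> A \<union> A\<inverse>}). ?h e)"
    by (subst sum.Sigma) (auto intro!: sum.cong)
  also have "(SIGMA i:UNIV. {j. (i, j) \<in> A \<union> A\<inverse>}) = A \<union> A\<inverse>" by auto
  also have "(\<Sum>e\<in>A \<union> A\<inverse>. ?h e) = (\<Sum>e\<in>A. ?h e) + (\<Sum>e\<in>A\<inverse>. ?h e)"
    using disj by (intro sum.union_disjoint) auto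
  also have "(\<Sum>e\<in>A\<inverse>. ?h e) = (\<Sum>e\<in>A. ?h (prod.swap e))"
    by (rule sum.reindex_bij_witness[of _ prod.swap prod.swap]) auto
  also have "(\<Sum>e\<in>A. ?h e) + (\<Sum>e\<in>A. ?h (prod.swap e))
      = (\<Sum>e\<in>A. (w (fst e) - w (snd e)) \<bullet> (m (fst e) - m (snd e)))"
    by (simp add: sum.distrib[symmetric] inner_diff_left inner_diff_right algebra_simps)
  finally show ?thesis .
qed

text \<open>Transports \<open>v\<close> along a path: the flow \<open>z\<close> has divergence
  \<open>v\<close> at \<open>i\<close> and \<open>- v\<close> at \<open>r\<close>, written weakly
  against test vectors \<open>w\<close>. Each step of the path adds flow on one edge.\<close>

lemma path_flow_exists:
  fixes E :: "('n::{finite,linorder} \<times> 'n) set" and v :: "'v::real_inner"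
  assumes "sym E" and "(r, i) \<in> E\<^sup>*"
  shows "\<exists>z. \<forall>w. (w i - w r) \<bullet> v = (\<Sum>e\<in>up_edges E. (w (fst e) - w (snd e)) \<bullet> z e)"
  using assms(2)
proof induction
  case base
  show ?case by (intro exI[of _ "\<lambda>_. 0"]) simp
next
  case (step k l)
  then obtain z where z: "\<And>w. (w k - w r) \<bullet> v
      = (\<Sum>e\<in>up_edges E. (w (fst e) - w (snd e)) \<bullet> z e)" by blast
  have extend: "\<exists>z. \<forall>w. (w l - w r) \<bullet> v
      = (\<Sum>e\<in>up_edges E. (w (fst e) - w (snd e)) \<bullet> z e)"
    if e: "e \<in> up_edges E" and u: "\<And>w. (w l - w k) \<bullet> v = (w (fst e) - w (snd e)) \<bullet> u"
    for e u
  proof (intro exI allI)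
    fix w
    have "(\<Sum>e'\<in>up_edges E. (w (fst e') - w (snd e')) \<bullet> (z e' + (if e' = e then u else 0)))
      = (\<Sum>e'\<in>up_edges E. (w (fst e') - w (snd e')) \<bullet> z e')
        + (\<Sum>e'\<in>up_edges E. if e' = e then (w (fst e') - w (snd e')) \<bullet> u else 0)"
      unfolding sum.distrib[symmetric] by (intro sum.cong) (auto simp: inner_add_right)
    also have "\<dots> = (w k - w r) \<bullet> v + (w l - w k) \<bullet> v"
      using e by (simp add: z u)
    finally show "(w l - w r) \<bullet> v
      = (\<Sum>e'\<in>up_edges E. (w (fst e') - w (snd e')) \<bullet> (z e' + (if e' = e then u else 0)))"
      by (simp add: inner_diff_left)
  qed
  \<comment> \<open>Flows live on upward pairs, so the sign of the added flow depends on the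
    direction in which the path crosses the edge; a loop adds nothing.\<close>
  consider "k = l" | "k < l" | "l < k" by fastforce
  then show ?case
  proof cases
    case 1
    with z show ?thesis by blast
  next
    case 2
    then show ?thesis
      using step(2) by (intro extend[of "(k, l)" "- v"])
        (auto simp: up_edges_def inner_diff_left)
  next
    case 3
    then show ?thesis
      using symD[OF \<open>sym E\<close> step(2)] by (intro extend[of "(l, k)" v]) (auto simp: up_edges_def)
  qed
qed

text \<open>Route each \<open>d i\<close> to a common root and superpose; the amounts collected at
  the root cancel because the \<open>d i\<close> sum to zero.\<close>

lemma flow_exists:
  fixes E :: "('n::{finite,linorder} \<times> 'n) set" and d :: "'n \<Rightarrow> 'v::real_inner"
  assumes E: "undirected_connected E" and d: "(\<Sum>i\<in>UNIV. d i) = 0"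
  shows "\<exists>z. \<forall>w. (\<Sum>i\<in>UNIV. w i \<bullet> d i)
    = (\<Sum>e\<in>up_edges E. (w (fst e) - w (snd e)) \<bullet> z e)"
proof -
  fix r :: 'n
  have "\<forall>i. \<exists>z. \<forall>w. (w i - w r) \<bullet> d i
      = (\<Sum>e\<in>up_edges E. (w (fst e) - w (snd e)) \<bullet> z e)"
    using E path_flow_exists[of E r] by (auto simp: undirected_connected_def)
  then obtain z where z: "\<And>i w. (w i - w r) \<bullet> d i
      = (\<Sum>e\<in>up_edges E. (w (fst e) - w (snd e)) \<bullet> z i e)" by metis
  have "(\<Sum>i\<in>UNIV. w i \<bullet> d i)
      = (\<Sum>e\<in>up_edges E. (w (fst e) - w (snd e)) \<bullet> (\<Sum>i\<in>UNIV. z i e))" for w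
  proof -
    have "(\<Sum>i\<in>UNIV. w i \<bullet> d i) = (\<Sum>i\<in>UNIV. (w i - w r) \<bullet> d i)"
      using d by (simp add: inner_diff_left sum_subtractf flip: inner_sum_right)
    also have "\<dots> = (\<Sum>e\<in>up_edges E. \<Sum>i\<in>UNIV. (w (fst e) - w (snd e)) \<bullet> z i e)"
      unfolding z by (rule sum.swap)
    finally show ?thesis by (simp add: inner_sum_right)
  qed
  then show ?thesis by (intro exI[of _ "\<lambda>e. \<Sum>i\<in>UNIV. z i e"] allI)
qed

section \<open>Continuity of convex functions on coordinate subspaces\<close>

text \<open>A proper coordinate subspace has empty interior, so continuity on open sets does not
  apply directly. Precomposing with the coordinate projection \<open>p\<close> extends
  \<open>h\<close> to a convex function on the whole space that agrees with it on the
  subspace.\<close>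

lemma convex_on_coord_space_imp_continuous_on:
  fixes h :: "real ^ 'd::finite \<Rightarrow> real"
  assumes h: "convex_on (coord_space J) h"
  shows "continuous_on (coord_space J) h"
proof -
  define p :: "real ^ 'd \<Rightarrow> real ^ 'd" where "p = (\<lambda>x. \<chi> k. if k \<in> J then x $ k else 0)"
  have p: "p x \<in> coord_space J" for x by (auto simp: p_def coord_space_def)
  have p_id: "p x = x" if "x \<in> coord_space J" for x
    using that by (auto simp: p_def coord_space_def vec_eq_iff)
  have lin: "p (u *\<^sub>R x + v *\<^sub>R y) = u *\<^sub>R p x + v *\<^sub>R p y" for u v x y
    by (auto simp: p_def vec_eq_iff)
  have "convex_on UNIV (h \<circ> p)"
    using h p unfolding convex_on_def by (auto simp: lin)
  then have "continuous_on UNIV (h \<circ> p)" by (rule convex_on_continuous[OF open_UNIV])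
  then have "continuous_on (coord_space J) (h \<circ> p)" by (rule continuous_on_subset) simp
  then show ?thesis by (rule continuous_on_eq) (simp add: p_id)
qed

section \<open>Expected drift of the edge flow\<close>

text \<open>Independence of the two sigma-algebras passes to the real random variables
  \<open>indicator A\<close> and \<open>h\<close>, for which the expectation of the product
  factors.\<close>

lemma (in prob_space) expectation_indicator_indep_set:
  fixes h :: "'a \<Rightarrow> real"
  assumes indep: "indep_set H C"
    and H: "sigma_algebra (space M) H" and C: "sigma_algebra (space M) C"
    and h: "\<And>B. B \<in> sets borel \<Longrightarrow> h -` B \<inter> space M \<in> H" and int: "integrable M h"
    and A: "A \<in> C"
  shows "(\<integral>\<omega>. indicator A \<omega> * h \<omega> \<partial>M) = prob A * (\<integral>\<omega>. h \<omega> \<partial>M)"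
    and "integrable M (\<lambda>\<omega>. indicator A \<omega> * h \<omega>)"
proof -
  have HC: "H \<subseteq> events" "C \<subseteq> events" using indep_setD_ev1[OF indep] indep_setD_ev2[OF indep] .
  have Ae: "A \<in> events" using A HC by blast
  have hm: "h \<in> borel_measurable M" using int by simp
  have HH: "sigma_sets (space M) {h -` B \<inter> space M |B. B \<in> sets borel} \<subseteq> H"
    using h by (intro sigma_algebra.sigma_sets_subset[OF H]) auto
  \<comment> \<open>A preimage under the indicator is empty, \<open>A\<close>, its complement or the
    whole space, and \<open>C\<close> contains all four.\<close>
  have "(indicator A :: 'a \<Rightarrow> real) -` B \<inter> space M \<in> C" for B
  proof -
    have "A \<subseteq> space M" using Ae sets.sets_into_space by auto
    then have "(indicator A :: 'a \<Rightarrow> real) -` B \<inter> space M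
      = (if 1 \<in> B then A else {}) \<union> (if 0 \<in> B then space M - A else {})"
      by (auto simp: indicator_def of_bool_def split: if_splits)
    also have "\<dots> \<in> C"
    proof -
      interpret C: sigma_algebra "space M" C by fact
      show ?thesis using A by auto
    qed
    finally show ?thesis .
  qed
  then have CC: "sigma_sets (space M)
      {(indicator A :: 'a \<Rightarrow> real) -` B \<inter> space M |B. B \<in> sets borel} \<subseteq> C"
    by (intro sigma_algebra.sigma_sets_subset[OF C]) auto
  have var: "indep_var borel (indicator A :: 'a \<Rightarrow> real) borel h"
    unfolding indep_var_eq
  proof (intro conjI indep_setI)
    show "(indicator A :: 'a \<Rightarrow> real) \<in> borel_measurable M" using Ae by simp
    show "h \<in> borel_measurable M" by fact
  next
    fix a b
    assume "a \<in> sigma_sets (space M) {(indicator A :: 'a \<Rightarrow> real) -` B \<inter> space M |B. B \<in> sets borel}"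
      and "b \<in> sigma_sets (space M) {h -` B \<inter> space M |B. B \<in> sets borel}"
    then have "prob (b \<inter> a) = prob b * prob a" using HH CC by (intro indep_setD[OF indep]) auto
    then show "prob (a \<inter> b) = prob a * prob b" by (simp add: Int_commute mult.commute)
  qed (use HH CC HC in auto)
  have iA: "integrable M (indicator A :: 'a \<Rightarrow> real)"
    using Ae by (simp add: integrable_indicator_iff emeasure_eq_measure)
  show "(\<integral>\<omega>. indicator A \<omega> * h \<omega> \<partial>M) = prob A * (\<integral>\<omega>. h \<omega> \<partial>M)"
    using indep_var_lebesgue_integral[OF var iA int] Ae by simp
  show "integrable M (\<lambda>\<omega>. indicator A \<omega> * h \<omega>)"
    by (rule indep_var_integrable[OF var iA int])
qed

section \<open>The past as a sigma-algebra\<close>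

lemma sigma_algebra_history: "sigma_algebra (space P) (history P E \<nu> \<mu> t)"
  unfolding history_def by (intro sigma_algebra_sigma_sets) auto

lemma sigma_algebra_current_activations:
  "sigma_algebra (space P) (current_activations P E \<nu> t)"
  unfolding current_activations_def by (intro sigma_algebra_sigma_sets) auto

text \<open>Packages the set family \<open>history\<close> as a measure space, so that closure of
  Borel functions under sums, products and inner products is available for functions of the
  past.\<close>

definition history_measure ::
  "'w measure \<Rightarrow> ('n::linorder \<times> 'n) set \<Rightarrow> ('n \<Rightarrow> 'n \<Rightarrow> nat \<Rightarrow> 'w \<Rightarrow> bool)
     \<Rightarrow> ('n \<Rightarrow> nat \<Rightarrow> 'w \<Rightarrow> real ^ 's) \<Rightarrow> nat \<Rightarrow> 'w measure" where
  "history_measure P E \<nu> \<mu> t = sigma (space P) (history P E \<nu> \<mu> t)"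

lemma space_history_measure [simp]: "space (history_measure P E \<nu> \<mu> t) = space P"
  by (simp add: history_measure_def space_measure_of_conv)

lemma sets_history_measure [simp]: "sets (history_measure P E \<nu> \<mu> t) = history P E \<nu> \<mu> t"
  using sigma_algebra.sets_measure_of_eq[OF sigma_algebra_history] by (simp add: history_measure_def)

lemma measurable_history_multiplier:
  fixes \<mu> :: "'n::linorder \<Rightarrow> nat \<Rightarrow> 'w \<Rightarrow> real ^ 's::finite"
  assumes "s \<le> t"
  shows "\<mu> i s \<in> borel_measurable (history_measure P E \<nu> \<mu> t)"
proof (rule measurableI)
  fix B :: "(real ^ 's) set" assume "B \<in> sets borel"
  then show "\<mu> i s -` B \<inter> space (history_measure P E \<nu> \<mu> t)
      \<in> sets (history_measure P E \<nu> \<mu> t)"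
    using assms by (auto simp: history_def intro!: sigma_sets.Basic)
qed simp

lemma measurable_history_activation:
  fixes \<mu> :: "'n::linorder \<Rightarrow> nat \<Rightarrow> 'w \<Rightarrow> real ^ 's::finite"
  assumes "(i, j) \<in> up_edges E" "s < t"
  shows "\<nu> i j s \<in> measurable (history_measure P E \<nu> \<mu> t) (count_space UNIV)"
proof (rule measurableI)
  fix B :: "bool set"
  show "\<nu> i j s -` B \<inter> space (history_measure P E \<nu> \<mu> t)
      \<in> sets (history_measure P E \<nu> \<mu> t)"
    using assms by (auto simp: history_def intro!: sigma_sets.Basic)
qed simp

text \<open>The total transfer across edge \<open>e\<close> before time \<open>t\<close>. Its
  divergence is the change of the vectors \<open>y\<close> since time 0, and each of its increments
  is switched by a single activation.\<close>

definition edge_flow ::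
  "(nat \<Rightarrow> real) \<Rightarrow> ('n \<Rightarrow> 'n \<Rightarrow> nat \<Rightarrow> 'w \<Rightarrow> bool) \<Rightarrow> ('n \<Rightarrow> nat \<Rightarrow> 'w \<Rightarrow> real ^ 's)
     \<Rightarrow> nat \<Rightarrow> 'w \<Rightarrow> 'n \<times> 'n \<Rightarrow> real ^ 's" where
  "edge_flow \<alpha> \<nu> \<mu> t \<omega> e = (\<Sum>s<t. (\<alpha> s * of_bool (\<nu> (fst e) (snd e) s \<omega>))
     *\<^sub>R (\<mu> (fst e) s \<omega> - \<mu> (snd e) s \<omega>))"

lemma edge_flow_Suc:
  "edge_flow \<alpha> \<nu> \<mu> (Suc t) \<omega> e = edge_flow \<alpha> \<nu> \<mu> t \<omega> e
     + (\<alpha> t * of_bool (\<nu> (fst e) (snd e) t \<omega>)) *\<^sub>R (\<mu> (fst e) t \<omega> - \<mu> (snd e) t \<omega>)"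
  by (simp add: edge_flow_def)

text \<open>The flow at time \<open>t\<close> sums over \<open>s < t\<close>, so it is determined
  before the activations of time \<open>t\<close> are drawn; this allows those activations to be
  averaged out.\<close>

lemma measurable_history_edge_flow:
  fixes \<mu> :: "'n::linorder \<Rightarrow> nat \<Rightarrow> 'w \<Rightarrow> real ^ 's::finite"
  assumes "e \<in> up_edges E"
  shows "(\<lambda>\<omega>. edge_flow \<alpha> \<nu> \<mu> t \<omega> e) \<in> borel_measurable (history_measure P E \<nu> \<mu> t)"
  unfolding edge_flow_def
proof (intro borel_measurable_sum borel_measurable_scaleR borel_measurable_times
    borel_measurable_const borel_measurable_diff measurable_history_multiplier)
  fix s assume "s \<in> {..<t}"
  then have [measurable]: "\<nu> (fst e) (snd e) s
      \<in> measurable (history_measure P E \<nu> \<mu> t) (count_space UNIV)"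
    using assms by (intro measurable_history_activation) auto
  show "(\<lambda>\<omega>. of_bool (\<nu> (fst e) (snd e) s \<omega>)) \<in> borel_measurable (history_measure P E \<nu> \<mu> t)"
    by measurable
qed auto

section \<open>Averaging over the activations\<close>

lemma random_activation_prob:
  assumes "prob_space P" and act: "random_activation P E \<sigma> \<nu>" and e: "(i, j) \<in> up_edges E"
  shows "measure P {\<omega> \<in> space P. \<nu> i j t \<omega>} = \<sigma> i j"
proof -
  interpret prob_space P by fact
  have "indep_vars (\<lambda>_. count_space UNIV) (\<lambda>t. \<nu> i j t) UNIV"
    and d: "distr P (count_space UNIV) (\<nu> i j t) = measure_pmf (bernoulli_pmf (\<sigma> i j))"
    and \<sigma>: "0 < \<sigma> i j" "\<sigma> i j \<le> 1"
    using act e by (auto simp: random_activation_def)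
  then have "\<nu> i j t \<in> measurable P (count_space UNIV)"
    by (auto simp: indep_vars_def2)
  then have "measure P (\<nu> i j t -` {True} \<inter> space P)
      = measure (measure_pmf (bernoulli_pmf (\<sigma> i j))) {True}"
    unfolding d[symmetric] by (subst measure_distr) auto
  also have "\<nu> i j t -` {True} \<inter> space P = {\<omega> \<in> space P. \<nu> i j t \<omega>}" by auto
  finally show ?thesis using \<sigma> by (simp add: measure_pmf_single)
qed

text \<open>The activation of time \<open>t\<close> is independent of whatever the past determines,
  so it averages to its probability. The multipliers of time \<open>t\<close> count as past.\<close>

lemma expectation_activation:
  fixes \<mu> :: "'n::linorder \<Rightarrow> nat \<Rightarrow> 'w \<Rightarrow> real ^ 's::finite" and h :: "'w \<Rightarrow> real"
  assumes P: "prob_space P" and act: "random_activation P E \<sigma> \<nu>"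
    and causal: "nonanticipating P E \<nu> \<mu>" and e: "(i, j) \<in> up_edges E"
    and h: "h \<in> borel_measurable (history_measure P E \<nu> \<mu> t)" and int: "integrable P h"
  shows "(\<integral>\<omega>. of_bool (\<nu> i j t \<omega>) * h \<omega> \<partial>P) = \<sigma> i j * (\<integral>\<omega>. h \<omega> \<partial>P)"
    and "integrable P (\<lambda>\<omega>. of_bool (\<nu> i j t \<omega>) * h \<omega>)"
proof -
  interpret prob_space P by fact
  let ?A = "{\<omega> \<in> space P. \<nu> i j t \<omega>}"
  have "?A = \<nu> i j t -` {True} \<inter> space P" by auto
  then have A: "?A \<in> current_activations P E \<nu> t"
    unfolding current_activations_def using e by (intro sigma_sets.Basic) blast
  have hH: "h -` B \<inter> space P \<in> history P E \<nu> \<mu> t" if "B \<in> sets borel" for B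
    using measurable_sets[OF h that] by simp
  have indep: "indep_set (history P E \<nu> \<mu> t) (current_activations P E \<nu> t)"
    using causal by (simp add: nonanticipating_def)
  note * = expectation_indicator_indep_set[OF indep sigma_algebra_history
    sigma_algebra_current_activations hH int A]
  have eq: "of_bool (\<nu> i j t \<omega>) * h \<omega> = indicator ?A \<omega> * h \<omega>" if "\<omega> \<in> space P" for \<omega>
    using that by (simp add: indicator_def)
  show "(\<integral>\<omega>. of_bool (\<nu> i j t \<omega>) * h \<omega> \<partial>P) = \<sigma> i j * (\<integral>\<omega>. h \<omega> \<partial>P)"
    using *(1) random_activation_prob[OF P act e]
    by (subst Bochner_Integration.integral_cong[OF refl eq]) auto
  show "integrable P (\<lambda>\<omega>. of_bool (\<nu> i j t \<omega>) * h \<omega>)"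
    using *(2) by (subst Bochner_Integration.integrable_cong[OF refl eq]) auto
qed

text \<open>The expectation of the infinite sum is the sum of the expectations, bounded through
  \<open>K\<close>, and a nonnegative variable with finite expectation is finite almost
  surely.\<close>

lemma AE_summable_if_sum_expectation_bounded:
  fixes b :: "nat \<Rightarrow> 'w \<Rightarrow> real"
  assumes int: "\<And>t. integrable P (b t)"
    and nonneg: "\<And>t \<omega>. \<omega> \<in> space P \<Longrightarrow> 0 \<le> b t \<omega>"
    and bound: "\<And>T. (\<Sum>t<T. \<integral>\<omega>. b t \<omega> \<partial>P) \<le> K"
  shows "AE \<omega> in P. summable (\<lambda>t. b t \<omega>)"
proof -
  have [measurable]: "b t \<in> borel_measurable P" for t using int by auto
  have "(\<integral>\<^sup>+\<omega>. (\<Sum>t. ennreal (b t \<omega>)) \<partial>P) = (\<Sum>t. \<integral>\<^sup>+\<omega>. ennreal (b t \<omega>) \<partial>P)"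
    by (rule nn_integral_suminf) measurable
  also have "\<dots> = (\<Sum>t. ennreal (\<integral>\<omega>. b t \<omega> \<partial>P))"
    using nonneg by (intro suminf_cong nn_integral_eq_integral int AE_I2) auto
  also have "\<dots> \<le> ennreal K"
  proof (rule suminf_le_const)
    fix n
    have "(\<Sum>t<n. ennreal (\<integral>\<omega>. b t \<omega> \<partial>P)) = ennreal (\<Sum>t<n. \<integral>\<omega>. b t \<omega> \<partial>P)"
      using nonneg by (intro sum_ennreal integral_nonneg_AE AE_I2) auto
    then show "(\<Sum>t<n. ennreal (\<integral>\<omega>. b t \<omega> \<partial>P)) \<le> ennreal K"
      using bound by (simp add: ennreal_leI)
  qed simp
  finally have "(\<integral>\<^sup>+\<omega>. (\<Sum>t. ennreal (b t \<omega>)) \<partial>P) \<noteq> \<infinity>"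
    by (auto simp: top_unique)
  then have "AE \<omega> in P. (\<Sum>t. ennreal (b t \<omega>)) \<noteq> \<infinity>"
    by (intro nn_integral_PInf_AE) measurable
  then show ?thesis
    using nonneg by (auto intro!: summable_suminf_not_top elim!: eventually_mono[OF eventually_conj[OF _ AE_space]])
qed

section \<open>Expected decrease of the Lyapunov function\<close>

text \<open>A deterministic bound for each \<open>t\<close>, though it may grow with
  \<open>t\<close>; it gives integrability of the terms that contain the flow.\<close>

lemma norm_edge_flow_le:
  assumes "\<And>s. 0 \<le> \<alpha> s" and "\<And>i s. norm (\<mu> i s \<omega>) \<le> M"
  shows "norm (edge_flow \<alpha> \<nu> \<mu> t \<omega> e) \<le> (\<Sum>s<t. \<alpha> s * (2 * M))"
  unfolding edge_flow_def
proof (rule sum_norm_le)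
  fix s
  have "norm (\<mu> (fst e) s \<omega> - \<mu> (snd e) s \<omega>) \<le> 2 * M"
    using norm_triangle_ineq4[of "\<mu> (fst e) s \<omega>" "\<mu> (snd e) s \<omega>"] assms(2)[of "fst e" s]
      assms(2)[of "snd e" s] by linarith
  then have "\<alpha> s * of_bool (\<nu> (fst e) (snd e) s \<omega>) * norm (\<mu> (fst e) s \<omega> - \<mu> (snd e) s \<omega>)
      \<le> \<alpha> s * (2 * M)"
    using assms(1)[of s] order_trans[OF norm_ge_zero assms(2)] by (intro mult_mono) auto
  then show "norm ((\<alpha> s * of_bool (\<nu> (fst e) (snd e) s \<omega>))
      *\<^sub>R (\<mu> (fst e) s \<omega> - \<mu> (snd e) s \<omega>)) \<le> \<alpha> s * (2 * M)"
    using assms(1)[of s] by (simp add: abs_mult)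
qed

text \<open>
  The Lyapunov function \<open>V\<close> weights the squared distance of the flow on edge \<open>e\<close> by
  \<open>1 / \<sigma> e\<close>: the weight cancels the activation probability, so that the expected drift
  is that of the subgradient method on the full graph.
\<close>

lemma AE_summable_edge_flow_drift:
  fixes \<mu> :: "'n::{finite,linorder} \<Rightarrow> nat \<Rightarrow> 'w \<Rightarrow> real ^ 's::finite"
    and zs :: "'n \<times> 'n \<Rightarrow> real ^ 's" and E :: "('n \<times> 'n) set"
    and \<nu> :: "'n \<Rightarrow> 'n \<Rightarrow> nat \<Rightarrow> 'w \<Rightarrow> bool" and \<alpha> :: "nat \<Rightarrow> real"
  defines "b \<equiv> \<lambda>t \<omega>. - (\<Sum>e\<in>up_edges E. (edge_flow \<alpha> \<nu> \<mu> t \<omega> e - zs e)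
    \<bullet> (\<mu> (fst e) t \<omega> - \<mu> (snd e) t \<omega>))"
  assumes P: "prob_space P" and act: "random_activation P E \<sigma> \<nu>"
    and causal: "nonanticipating P E \<nu> \<mu>"
    and \<alpha>: "\<And>t. 0 \<le> \<alpha> t" and sq: "summable (\<lambda>t. (\<alpha> t)\<^sup>2)"
    and bounded: "\<And>i t \<omega>. \<omega> \<in> space P \<Longrightarrow> norm (\<mu> i t \<omega>) \<le> M"
    and b_nonneg: "\<And>t \<omega>. \<omega> \<in> space P \<Longrightarrow> 0 \<le> b t \<omega>"
  shows "AE \<omega> in P. summable (\<lambda>t. \<alpha> t * b t \<omega>)"
proof -
  interpret prob_space P by fact
  define I where "I = (\<lambda>e t \<omega>. of_bool (\<nu> (fst e) (snd e) t \<omega>) :: real)"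
  define D where "D = (\<lambda>e t \<omega>. \<mu> (fst e) t \<omega> - \<mu> (snd e) t \<omega>)"
  define u where "u = (\<lambda>e t \<omega>. edge_flow \<alpha> \<nu> \<mu> t \<omega> e - zs e)"
  define w where "w = (\<lambda>e. \<sigma> (fst e) (snd e))"
  define V where "V = (\<lambda>t \<omega>. \<Sum>e\<in>up_edges E. (1 / w e) * (norm (u e t \<omega>))\<^sup>2)"
  define B where "B = (\<lambda>e t. (\<Sum>s<t. \<alpha> s * (2 * M)) + norm (zs e))"
  \<comment> \<open>Bounds the expected squared multiplier differences summed over the edges; with
    square-summable steps it controls the second-order error.\<close>
  define K where "K = (\<Sum>e\<in>up_edges E. (1 / w e) * (2 * M)\<^sup>2)"
  have w: "0 < w e" if "e \<in> up_edges E" for e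
    using act that by (auto simp: random_activation_def w_def)
  have M: "0 \<le> M"
  proof -
    obtain \<omega> where "\<omega> \<in> space P" using not_empty by blast
    then show ?thesis using order_trans[OF norm_ge_zero bounded] by blast
  qed
  have sub: "subalgebra P (history_measure P E \<nu> \<mu> t)" for t
    using causal indep_setD_ev1 by (auto simp: subalgebra_def nonanticipating_def)
  have uH: "u e t \<in> borel_measurable (history_measure P E \<nu> \<mu> t)" if "e \<in> up_edges E" for e t
    unfolding u_def
    by (intro borel_measurable_diff borel_measurable_const measurable_history_edge_flow that)
  have DH: "D e t \<in> borel_measurable (history_measure P E \<nu> \<mu> t)" for e t
    unfolding D_def by (intro borel_measurable_diff measurable_history_multiplier order_refl)
  have hH: "(\<lambda>\<omega>. u e t \<omega> \<bullet> D e t \<omega>) \<in> borel_measurable (history_measure P E \<nu> \<mu> t)"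
    if "e \<in> up_edges E" for e t
    using uH[OF that] DH by simp
  have dH: "(\<lambda>\<omega>. (norm (D e t \<omega>))\<^sup>2) \<in> borel_measurable (history_measure P E \<nu> \<mu> t)" for e t
    using DH by simp
  have D_le: "norm (D e t \<omega>) \<le> 2 * M" if "\<omega> \<in> space P" for e t \<omega>
    unfolding D_def using norm_triangle_ineq4[of "\<mu> (fst e) t \<omega>" "\<mu> (snd e) t \<omega>"]
      bounded[OF that, of "fst e" t] bounded[OF that, of "snd e" t] by linarith
  have u_le: "norm (u e t \<omega>) \<le> B e t" if "\<omega> \<in> space P" for e t \<omega>
    unfolding u_def B_def
    using norm_triangle_ineq4[of "edge_flow \<alpha> \<nu> \<mu> t \<omega> e" "zs e"]
      norm_edge_flow_le[of \<alpha> \<mu> \<omega> M \<nu> t e, OF \<alpha> bounded[OF that]] by linarith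
  have B: "0 \<le> B e t" for e t
    unfolding B_def using M \<alpha> by (intro add_nonneg_nonneg sum_nonneg) auto
  have int_d: "integrable P (\<lambda>\<omega>. (norm (D e t \<omega>))\<^sup>2)" for e t
  proof (rule integrable_const_bound[where B = "(2 * M)\<^sup>2"])
    show "AE \<omega> in P. norm ((norm (D e t \<omega>))\<^sup>2) \<le> (2 * M)\<^sup>2"
      using power_mono[OF D_le norm_ge_zero, of _ e t 2] by (intro AE_I2) simp
  qed (rule measurable_from_subalg[OF sub dH])
  have int_h: "integrable P (\<lambda>\<omega>. u e t \<omega> \<bullet> D e t \<omega>)" if "e \<in> up_edges E" for e t
  proof (rule integrable_const_bound[where B = "B e t * (2 * M)"])
    show "AE \<omega> in P. norm (u e t \<omega> \<bullet> D e t \<omega>) \<le> B e t * (2 * M)"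
    proof (rule AE_I2)
      fix \<omega> assume "\<omega> \<in> space P"
      then have "norm (u e t \<omega>) * norm (D e t \<omega>) \<le> B e t * (2 * M)"
        using D_le u_le B M by (intro mult_mono) auto
      then show "norm (u e t \<omega> \<bullet> D e t \<omega>) \<le> B e t * (2 * M)"
        using Cauchy_Schwarz_ineq2[of "u e t \<omega>" "D e t \<omega>"] by simp
    qed
  qed (rule measurable_from_subalg[OF sub hH[OF that]])
  have int_u: "integrable P (\<lambda>\<omega>. (norm (u e t \<omega>))\<^sup>2)" if "e \<in> up_edges E" for e t
  proof (rule integrable_const_bound[where B = "(B e t)\<^sup>2"])
    show "(\<lambda>\<omega>. (norm (u e t \<omega>))\<^sup>2) \<in> borel_measurable P"
      using measurable_from_subalg[OF sub uH[OF that]] by simp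
    show "AE \<omega> in P. norm ((norm (u e t \<omega>))\<^sup>2) \<le> (B e t)\<^sup>2"
      using power_mono[OF u_le norm_ge_zero, of _ e t 2] by (intro AE_I2) simp
  qed
  have Ed: "(\<integral>\<omega>. I e t \<omega> * (norm (D e t \<omega>))\<^sup>2 \<partial>P) = w e * (\<integral>\<omega>. (norm (D e t \<omega>))\<^sup>2 \<partial>P)"
    "integrable P (\<lambda>\<omega>. I e t \<omega> * (norm (D e t \<omega>))\<^sup>2)"
    if "e \<in> up_edges E" for e t
    using expectation_activation[OF P act causal _ dH int_d, of "fst e" "snd e"] that
    by (simp_all add: I_def w_def)
  have Eh: "(\<integral>\<omega>. I e t \<omega> * (u e t \<omega> \<bullet> D e t \<omega>) \<partial>P) = w e * (\<integral>\<omega>. u e t \<omega> \<bullet> D e t \<omega> \<partial>P)"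
    "integrable P (\<lambda>\<omega>. I e t \<omega> * (u e t \<omega> \<bullet> D e t \<omega>))"
    if "e \<in> up_edges E" for e t
    using expectation_activation[OF P act causal _ hH[OF that] int_h[OF that], of "fst e" "snd e"] that
    by (simp_all add: I_def w_def)
  \<comment> \<open>The switch \<open>I\<close> takes the values 0 and 1, so in the quadratic term
    its square is itself.\<close>
  have u_Suc: "(norm (u e (Suc t) \<omega>))\<^sup>2 = (norm (u e t \<omega>))\<^sup>2
      + 2 * \<alpha> t * (I e t \<omega> * (u e t \<omega> \<bullet> D e t \<omega>)) + (\<alpha> t)\<^sup>2 * (I e t \<omega> * (norm (D e t \<omega>))\<^sup>2)" for e t \<omega>
  proof -
    have "u e (Suc t) \<omega> = u e t \<omega> + (\<alpha> t * I e t \<omega>) *\<^sub>R D e t \<omega>"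
      by (simp add: u_def I_def D_def edge_flow_Suc)
    moreover have "I e t \<omega> = 0 \<or> I e t \<omega> = 1" by (simp add: I_def)
    ultimately show ?thesis
      unfolding power2_norm_eq_inner
      by (auto simp: inner_add_left inner_add_right inner_commute power2_eq_square algebra_simps)
  qed
  have int_V: "integrable P (V t)" for t
    unfolding V_def using int_u by simp
  have b_eq: "b t \<omega> = - (\<Sum>e\<in>up_edges E. u e t \<omega> \<bullet> D e t \<omega>)" for t \<omega>
    by (simp add: b_def u_def D_def)
  have int_b: "integrable P (b t)" for t
    unfolding b_eq using int_h by simp
  have drift: "2 * \<alpha> t * (\<integral>\<omega>. b t \<omega> \<partial>P) \<le> (\<integral>\<omega>. V t \<omega> \<partial>P) - (\<integral>\<omega>. V (Suc t) \<omega> \<partial>P) + (\<alpha> t)\<^sup>2 * K" for t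
  proof -
    have E_Suc: "(\<integral>\<omega>. (norm (u e (Suc t) \<omega>))\<^sup>2 \<partial>P) = (\<integral>\<omega>. (norm (u e t \<omega>))\<^sup>2 \<partial>P)
      + 2 * \<alpha> t * (w e * (\<integral>\<omega>. u e t \<omega> \<bullet> D e t \<omega> \<partial>P))
      + (\<alpha> t)\<^sup>2 * (w e * (\<integral>\<omega>. (norm (D e t \<omega>))\<^sup>2 \<partial>P))" if e: "e \<in> up_edges E" for e
      unfolding u_Suc using Ed[OF e, of t] Eh[OF e, of t] int_u[OF e, of t] by simp
    have "(\<integral>\<omega>. V (Suc t) \<omega> \<partial>P)
        = (\<Sum>e\<in>up_edges E. (1 / w e) * (\<integral>\<omega>. (norm (u e (Suc t) \<omega>))\<^sup>2 \<partial>P))"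
      unfolding V_def using int_u by simp
    \<comment> \<open>The factor \<open>w e\<close> produced by averaging cancels the weight
      \<open>1 / w e\<close> in the two terms that involve activations.\<close>
    also have "\<dots> = (\<Sum>e\<in>up_edges E. (1 / w e) * (\<integral>\<omega>. (norm (u e t \<omega>))\<^sup>2 \<partial>P)
        + 2 * \<alpha> t * (\<integral>\<omega>. u e t \<omega> \<bullet> D e t \<omega> \<partial>P) + (\<alpha> t)\<^sup>2 * (\<integral>\<omega>. (norm (D e t \<omega>))\<^sup>2 \<partial>P))"
      using w by (intro sum.cong refl) (force simp: E_Suc field_simps)
    also have "\<dots> = (\<integral>\<omega>. V t \<omega> \<partial>P) - 2 * \<alpha> t * (\<integral>\<omega>. b t \<omega> \<partial>P)
        + (\<alpha> t)\<^sup>2 * (\<Sum>e\<in>up_edges E. \<integral>\<omega>. (norm (D e t \<omega>))\<^sup>2 \<partial>P)"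
      unfolding V_def b_eq using int_u int_h by (simp add: sum.distrib sum_distrib_left)
    also have "\<dots> \<le> (\<integral>\<omega>. V t \<omega> \<partial>P) - 2 * \<alpha> t * (\<integral>\<omega>. b t \<omega> \<partial>P) + (\<alpha> t)\<^sup>2 * K"
    proof -
      have "(\<integral>\<omega>. (norm (D e t \<omega>))\<^sup>2 \<partial>P) \<le> (1 / w e) * (2 * M)\<^sup>2" if e: "e \<in> up_edges E" for e
      proof -
        have "(\<integral>\<omega>. (norm (D e t \<omega>))\<^sup>2 \<partial>P) \<le> (\<integral>\<omega>. (2 * M)\<^sup>2 \<partial>P)"
          using D_le by (intro integral_mono int_d power_mono) auto
        also have "\<dots> = 1 * (2 * M)\<^sup>2" by (simp add: prob_space)
        also have "\<dots> \<le> (1 / w e) * (2 * M)\<^sup>2"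
        proof (rule mult_right_mono)
          have "w e \<le> 1" using act e by (auto simp: random_activation_def w_def)
          then show "1 \<le> 1 / w e" using w[OF e] by simp
        qed simp
        finally show ?thesis .
      qed
      then show ?thesis unfolding K_def by (intro add_left_mono mult_left_mono sum_mono) auto
    qed
    finally show ?thesis by simp
  qed
  have V: "0 \<le> (\<integral>\<omega>. V t \<omega> \<partial>P)" for t
    unfolding V_def using w by (intro integral_nonneg_AE AE_I2 sum_nonneg) (simp add: less_imp_le)
  have K: "0 \<le> K" unfolding K_def using w by (intro sum_nonneg) (simp add: less_imp_le)
  show ?thesis
  proof (rule AE_summable_if_sum_expectation_bounded)
    fix T
    \<comment> \<open>Summing the drift telescopes the expectations of \<open>V\<close>; the final
      one is nonnegative and is dropped, leaving a bound independent of \<open>T\<close>.\<close>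
    have "(\<Sum>t<T. 2 * (\<alpha> t * (\<integral>\<omega>. b t \<omega> \<partial>P)))
        \<le> (\<Sum>t<T. ((\<integral>\<omega>. V t \<omega> \<partial>P) - (\<integral>\<omega>. V (Suc t) \<omega> \<partial>P)) + (\<alpha> t)\<^sup>2 * K)"
      using drift by (intro sum_mono) (simp add: mult.assoc)
    also have "\<dots> = (\<integral>\<omega>. V 0 \<omega> \<partial>P) - (\<integral>\<omega>. V T \<omega> \<partial>P) + (\<Sum>t<T. (\<alpha> t)\<^sup>2) * K"
      by (simp add: sum.distrib sum_distrib_right
          sum_lessThan_telescope'[of "\<lambda>t. \<integral>\<omega>. V t \<omega> \<partial>P"])
    also have "\<dots> \<le> (\<integral>\<omega>. V 0 \<omega> \<partial>P) + (\<Sum>t. (\<alpha> t)\<^sup>2) * K"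
      using V[of T] mult_right_mono[OF sum_le_suminf[OF sq, of "{..<T}"] K] by simp
    finally show "(\<Sum>t<T. \<integral>\<omega>. \<alpha> t * b t \<omega> \<partial>P)
        \<le> ((\<integral>\<omega>. V 0 \<omega> \<partial>P) + (\<Sum>t. (\<alpha> t)\<^sup>2) * K) / 2"
      by (simp flip: sum_distrib_left)
  qed (use int_b b_nonneg \<alpha> in auto)
qed

section \<open>The constraint-coupled problem and runs of the algorithm\<close>

text \<open>The vectors \<open>y\<close> are \<open>y0\<close> plus the divergence of
  \<open>edge_flow\<close>, in weak form. A constant \<open>w\<close> yields conservation of the sum
  of the \<open>y i\<close>; the multipliers as \<open>w\<close> yield the pairing with
  subgradients.\<close>

lemma dpd_tv_weak_form:
  fixes y0 :: "'n::{finite,linorder} \<Rightarrow> real ^ 's::finite"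
  assumes run: "dpd_tv M f g X \<alpha> (active_edges E \<nu> \<omega>) y0
      y x \<rho> (\<lambda>i t. \<mu> i t \<omega>)"
  shows "(\<Sum>i\<in>UNIV. w i \<bullet> y i t) = (\<Sum>i\<in>UNIV. w i \<bullet> y0 i)
    + (\<Sum>e\<in>up_edges E. (w (fst e) - w (snd e)) \<bullet> edge_flow \<alpha> \<nu> \<mu> t \<omega> e)"
proof (induction t)
  case 0
  then show ?case using run by (simp add: dpd_tv_def edge_flow_def)
next
  case (Suc t)
  define A where "A = {e \<in> up_edges E. \<nu> (fst e) (snd e) t \<omega>}"
  have act: "active_edges E \<nu> \<omega> t = A \<union> A\<inverse>"
  proof -
    have "{(i, j) \<in> up_edges E. \<nu> i j t \<omega>} = A" by (auto simp: A_def)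
    then show ?thesis by (simp add: active_edges_def Let_def)
  qed
  have y: "y i (Suc t) = y i t
      + \<alpha> t *\<^sub>R (\<Sum>j\<in>{j. (i, j) \<in> A \<union> A\<inverse>}. \<mu> i t \<omega> - \<mu> j t \<omega>)" for i
    using run unfolding act[symmetric] dpd_tv_def by blast
  have "(\<Sum>i\<in>UNIV. w i \<bullet> y i (Suc t)) = (\<Sum>i\<in>UNIV. w i \<bullet> y i t)
      + \<alpha> t * (\<Sum>i\<in>UNIV. w i \<bullet> (\<Sum>j\<in>{j. (i, j) \<in> A \<union> A\<inverse>}. \<mu> i t \<omega> - \<mu> j t \<omega>))"
    unfolding y inner_add_right inner_scaleR_right sum.distrib sum_distrib_left ..
  also have "(\<Sum>i\<in>UNIV. w i \<bullet> (\<Sum>j\<in>{j. (i, j) \<in> A \<union> A\<inverse>}. \<mu> i t \<omega> - \<mu> j t \<omega>))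
      = (\<Sum>e\<in>A. (w (fst e) - w (snd e)) \<bullet> (\<mu> (fst e) t \<omega> - \<mu> (snd e) t \<omega>))"
    by (rule Laplacian_weak_form[of A E]) (auto simp: A_def)
  \<comment> \<open>Inactive edges enter with factor 0, so the sum runs over a set of edges that
    does not depend on the realisation.\<close>
  also have "\<dots> = (\<Sum>e\<in>up_edges E. of_bool (\<nu> (fst e) (snd e) t \<omega>)
      * ((w (fst e) - w (snd e)) \<bullet> (\<mu> (fst e) t \<omega> - \<mu> (snd e) t \<omega>)))"
    unfolding A_def by (subst sum.inter_filter, simp, intro sum.cong refl, simp)
  also have "(\<Sum>i\<in>UNIV. w i \<bullet> y i t) + \<alpha> t * \<dots> = (\<Sum>i\<in>UNIV. w i \<bullet> y0 i)
    + (\<Sum>e\<in>up_edges E. (w (fst e) - w (snd e)) \<bullet> edge_flow \<alpha> \<nu> \<mu> (Suc t) \<omega> e)"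
    unfolding Suc.IH edge_flow_Suc inner_add_right inner_scaleR_right sum.distrib sum_distrib_left
    by (simp add: mult.assoc)
  finally show ?case .
qed

section \<open>The deterministic problem: existence, duality and exact penalty\<close>

text \<open>Holds the data that involve no randomness; its facts about runs are applied to each
  realisation separately.\<close>

locale constraint_coupled_problem =
  fixes J :: "'n::finite \<Rightarrow> 'd::finite set"
    and X :: "'n \<Rightarrow> (real ^ 'd) set"
    and f :: "'n \<Rightarrow> real ^ 'd \<Rightarrow> real"
    and g :: "'n \<Rightarrow> real ^ 'd \<Rightarrow> real ^ 's::finite"
    and xs :: "'n \<Rightarrow> real ^ 'd"
    and m :: "real ^ 's"
    and M :: real
  assumes X: "\<And>i. X i \<subseteq> coord_space (J i) \<and> X i \<noteq> {} \<and> convex (X i) \<and> compact (X i)"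
    and f: "\<And>i. convex_on (coord_space (J i)) (f i)"
    and g: "\<And>i s. convex_on (coord_space (J i)) (\<lambda>x. g i x $ s)"
    and slater: "\<And>i. xs i \<in> X i" "\<And>s. (\<Sum>i\<in>UNIV. g i (xs i)) $ s < 0"
    and multiplier: "optimal_multiplier (total_cost f) (local_sets X) (coupling g) m"
    and M: "M > norm_1 m"
begin

lemma convex_on_f: "convex_on (X i) (f i)"
  using convex_on_subset[OF f] X by blast

lemma convex_on_g: "convex_on (X i) (\<lambda>x. g i x $ s)"
  using convex_on_subset[OF g] X by blast

lemma M_pos: "0 < M"
  using M norm_le_norm_1[of m] norm_ge_zero[of m] by linarith

lemma convex_local_sets: "convex (local_sets X)"
  using X by (auto simp: convex_def local_sets_def)

lemma compact_local_sets: "compact (local_sets X)"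
proof -
  have "bounded (X i)" for i using X compact_imp_bounded by blast
  then have "\<forall>i. \<exists>B. \<forall>x\<in>X i. norm x \<le> B" by (simp add: bounded_iff)
  then obtain B where B: "\<And>i x. x \<in> X i \<Longrightarrow> norm x \<le> B i" by metis
  have "norm x \<le> (\<Sum>i\<in>UNIV. B i)" if "x \<in> local_sets X" for x
  proof -
    have "norm x \<le> (\<Sum>i\<in>UNIV. norm (x $ i))"
      unfolding norm_vec_def by (rule L2_set_le_sum) simp
    also have "\<dots> \<le> (\<Sum>i\<in>UNIV. B i)"
      using that B by (intro sum_mono) (auto simp: local_sets_def)
    finally show ?thesis .
  qed
  then have "bounded (local_sets X)" by (auto simp: bounded_iff)
  moreover have "closed (local_sets X)"
  proof -
    have "local_sets X = (\<Inter>i. (\<lambda>x. x $ i) -` X i)" by (auto simp: local_sets_def)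
    moreover have "closed ((\<lambda>x :: (real ^ 'd) ^ 'n. x $ i) -` X i)" for i
      using X compact_imp_closed
      by (intro closed_vimage continuous_intros) blast
    ultimately show ?thesis by auto
  qed
  ultimately show ?thesis by (simp add: compact_eq_bounded_closed)
qed

lemma convex_on_total_cost: "convex_on (local_sets X) (total_cost f)"
  unfolding convex_on_def
proof (intro conjI convex_local_sets ballI allI impI)
  fix x x' :: "(real ^ 'd) ^ 'n" and u v :: real
  assume *: "x \<in> local_sets X" "x' \<in> local_sets X" "0 \<le> u" "0 \<le> v" "u + v = 1"
  then have "f i (u *\<^sub>R x $ i + v *\<^sub>R x' $ i) \<le> u * f i (x $ i) + v * f i (x' $ i)" for i
    using convex_on_f[of i] by (auto simp: convex_on_def local_sets_def)
  then show "total_cost f (u *\<^sub>R x + v *\<^sub>R x') \<le> u * total_cost f x + v * total_cost f x'"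
    unfolding total_cost_def sum_distrib_left sum.distrib[symmetric] by (intro sum_mono) simp
qed

lemma convex_on_coupling: "convex_on (local_sets X) (\<lambda>x. coupling g x $ s)"
  unfolding convex_on_def
proof (intro conjI convex_local_sets ballI allI impI)
  fix x x' :: "(real ^ 'd) ^ 'n" and u v :: real
  assume *: "x \<in> local_sets X" "x' \<in> local_sets X" "0 \<le> u" "0 \<le> v" "u + v = 1"
  then have "g i (u *\<^sub>R x $ i + v *\<^sub>R x' $ i) $ s \<le> u * g i (x $ i) $ s + v * g i (x' $ i) $ s" for i
    using convex_on_g[of i s] by (auto simp: convex_on_def local_sets_def)
  then show "coupling g (u *\<^sub>R x + v *\<^sub>R x') $ s \<le> u * coupling g x $ s + v * coupling g x' $ s"
    unfolding coupling_def sum_component sum_distrib_left sum.distrib[symmetric]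
    by (intro sum_mono) simp
qed

lemma continuous_on_convex_component:
  fixes h :: "real ^ 'd \<Rightarrow> real"
  assumes "convex_on (coord_space (J i)) h"
  shows "continuous_on (local_sets X) (\<lambda>x. h (x $ i))"
  by (rule continuous_on_compose2[OF convex_on_coord_space_imp_continuous_on[OF assms]])
    (use X in \<open>auto simp: local_sets_def intro!: continuous_intros\<close>)

lemma continuous_on_total_cost: "continuous_on (local_sets X) (total_cost f)"
  unfolding total_cost_def using f by (intro continuous_on_sum continuous_on_convex_component)

lemma continuous_on_coupling: "continuous_on (local_sets X) (\<lambda>x. coupling g x $ s)"
  unfolding coupling_def sum_component using g by (intro continuous_on_sum continuous_on_convex_component)

text \<open>The feasible set is compact, as the constraints are continuous on
  \<open>local_sets X\<close>, and it contains the Slater point, so the continuous cost attains its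
  minimum.\<close>

lemma optimal_solution_exists:
  "\<exists>x. optimal_solution (total_cost f) (local_sets X) (coupling g) x"
proof -
  let ?F = "feasible (local_sets X) (coupling g)"
  have "?F = local_sets X \<inter> (\<Inter>s. local_sets X \<inter> (\<lambda>x. coupling g x $ s) -` {..0})"
    by (auto simp: feasible_def less_eq_vec_def)
  moreover have "closed (local_sets X \<inter> (\<lambda>x. coupling g x $ s) -` {..0})" for s
    using compact_imp_closed[OF compact_local_sets]
    by (intro continuous_closed_preimage continuous_on_coupling) auto
  ultimately have "compact ?F"
    using compact_Int_closed[OF compact_local_sets] by (metis closed_INT)
  moreover have "(\<chi> i. xs i) \<in> ?F"
    using slater by (auto simp: feasible_def local_sets_def coupling_def less_eq_vec_def less_imp_le)
  moreover have "continuous_on ?F (total_cost f)"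
    by (rule continuous_on_subset[OF continuous_on_total_cost]) (auto simp: feasible_def)
  ultimately obtain x where "x \<in> ?F" "\<forall>z\<in>?F. total_cost f x \<le> total_cost f z"
    using continuous_attains_inf[of ?F] by blast
  then show ?thesis by (auto simp: optimal_solution_def is_arg_min_def not_less)
qed

lemma optimal_cost_eq:
  assumes "optimal_solution (total_cost f) (local_sets X) (coupling g) x"
  shows "optimal_cost (total_cost f) (local_sets X) (coupling g) = total_cost f x"
  unfolding optimal_cost_def
  by (rule cInf_eq_minimum)
    (use assms in \<open>auto simp: optimal_solution_def is_arg_min_def not_less\<close>)

abbreviation "opt_cost \<equiv> optimal_cost (total_cost f) (local_sets X) (coupling g)"

lemma strong_duality:
  shows "0 \<le> m" and "x \<in> local_sets X \<Longrightarrow> opt_cost \<le> total_cost f x + m \<bullet> coupling g x"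
proof -
  obtain xo where xo: "optimal_solution (total_cost f) (local_sets X) (coupling g) xo"
    using optimal_solution_exists by blast
  have sl: "(\<chi> i. xs i) \<in> local_sets X" "\<And>s. coupling g (\<chi> i. xs i) $ s < 0"
    using slater by (auto simp: local_sets_def coupling_def)
  have lower: "opt_cost \<le> total_cost f z" if "z \<in> feasible (local_sets X) (coupling g)" for z
    using xo that unfolding optimal_cost_eq[OF xo]
    by (auto simp: optimal_solution_def is_arg_min_def not_less)
  note sd = optimal_multiplier_strong_duality[OF convex_on_total_cost convex_on_coupling sl
      lower multiplier]
  show "0 \<le> m" by (rule sd(1))
  show "opt_cost \<le> total_cost f x + m \<bullet> coupling g x" if "x \<in> local_sets X"
    using sd(2)[of x] that by blast
qed

text \<open>The penalty on the relaxations \<open>\<rho>\<close> is exact because \<open>M\<close> exceeds the norm of \<open>m\<close>.\<close>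

lemma penalty_lower_bound:
  assumes "x \<in> local_sets X" and G: "coupling g x \<le> r *\<^sub>R 1"
  shows "opt_cost + (M - norm_1 m) * r \<le> total_cost f x + M * r"
proof -
  have "m \<bullet> coupling g x \<le> m \<bullet> (r *\<^sub>R 1)"
    by (rule inner_mono_nonneg_vec[OF strong_duality(1) G])
  also have "\<dots> = r * norm_1 m" using norm_1_nonneg_eq[OF strong_duality(1)] by simp
  finally show ?thesis using strong_duality(2)[OF assms(1)] by (simp add: algebra_simps)
qed

text \<open>The cost gap bounds \<open>(M - norm_1 m) * r t\<close>, so the relaxations vanish. By
  continuity the limit point is then feasible and has optimal cost.\<close>

lemma limit_point_optimal:
  fixes x :: "nat \<Rightarrow> (real ^ 'd) ^ 'n" and r :: "nat \<Rightarrow> real"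
  assumes x: "\<And>t. x t \<in> local_sets X" and r: "\<And>t. 0 \<le> r t"
    and G: "\<And>t. coupling g (x t) \<le> r t *\<^sub>R 1"
    and lim: "(\<lambda>t. total_cost f (x t) + M * r t) \<longlonglongrightarrow> opt_cost"
    and l: "limit_point x l"
  shows "optimal_solution (total_cost f) (local_sets X) (coupling g) l"
proof -
  have "(\<lambda>t. total_cost f (x t) + M * r t - opt_cost) \<longlonglongrightarrow> 0"
    using tendsto_diff[OF lim tendsto_const, of opt_cost] by simp
  then have "(\<lambda>t. (M - norm_1 m) * r t) \<longlonglongrightarrow> 0"
  proof (rule tendsto_sandwich[OF _ _ tendsto_const, rotated 2])
    have "0 \<le> (M - norm_1 m) * r t" for t using M r[of t] by simp
    then show "eventually (\<lambda>t. 0 \<le> (M - norm_1 m) * r t) sequentially" by simp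
    have "(M - norm_1 m) * r t \<le> total_cost f (x t) + M * r t - opt_cost" for t
      using penalty_lower_bound[OF x G, of t] by simp
    then show "eventually (\<lambda>t. (M - norm_1 m) * r t
        \<le> total_cost f (x t) + M * r t - opt_cost) sequentially" by simp
  qed
  then have "(\<lambda>t. inverse (M - norm_1 m) * ((M - norm_1 m) * r t)) \<longlonglongrightarrow> inverse (M - norm_1 m) * 0"
    by (rule tendsto_mult_left)
  then have r0: "r \<longlonglongrightarrow> 0" using M by (simp flip: mult.assoc)
  obtain k where k: "strict_mono k" "(x \<circ> k) \<longlonglongrightarrow> l"
    using l by (auto simp: limit_point_def)
  have lX: "l \<in> local_sets X"
    by (rule closed_sequentially[OF compact_imp_closed[OF compact_local_sets] _ k(2)]) (simp add: x)
  have along: "(\<lambda>n. h (x (k n))) \<longlonglongrightarrow> h l" if "continuous_on (local_sets X) h"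
    for h :: "(real ^ 'd) ^ 'n \<Rightarrow> real"
    using continuous_on_tendsto_compose[OF that k(2) lX] x by simp
  have rk: "(\<lambda>n. r (k n)) \<longlonglongrightarrow> 0"
    using LIMSEQ_subseq_LIMSEQ[OF r0 k(1)] by (simp add: o_def)
  have "(\<lambda>n. total_cost f (x (k n)) + M * r (k n)) \<longlonglongrightarrow> total_cost f l + M * 0"
    by (intro tendsto_intros rk along continuous_on_total_cost)
  moreover have "(\<lambda>n. total_cost f (x (k n)) + M * r (k n)) \<longlonglongrightarrow> opt_cost"
    using LIMSEQ_subseq_LIMSEQ[OF lim k(1)] by (simp add: o_def)
  ultimately have cost: "total_cost f l = opt_cost"
    using LIMSEQ_unique by fastforce
  have "coupling g l $ s \<le> 0" for s
  proof (rule LIMSEQ_le[OF along[OF continuous_on_coupling] rk])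
    show "\<exists>N. \<forall>n\<ge>N. coupling g (x (k n)) $ s \<le> r (k n)"
      using G by (auto simp: less_eq_vec_def)
  qed
  then have "l \<in> feasible (local_sets X) (coupling g)"
    using lX by (simp add: feasible_def less_eq_vec_def)
  moreover obtain xo where xo: "optimal_solution (total_cost f) (local_sets X) (coupling g) xo"
    using optimal_solution_exists by blast
  ultimately show ?thesis
    using cost optimal_cost_eq[OF xo] by (simp add: optimal_solution_def is_arg_min_def)
qed

section \<open>Runs along a fixed realisation\<close>

context
  fixes \<alpha> :: "nat \<Rightarrow> real" and EE :: "nat \<Rightarrow> ('n \<times> 'n) set" and y0 :: "'n \<Rightarrow> real ^ 's"
    and y :: "'n \<Rightarrow> nat \<Rightarrow> real ^ 's" and x :: "'n \<Rightarrow> nat \<Rightarrow> real ^ 'd"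
    and \<rho> :: "'n \<Rightarrow> nat \<Rightarrow> real" and \<mu> :: "'n \<Rightarrow> nat \<Rightarrow> real ^ 's"
  assumes run: "dpd_tv M f g X \<alpha> EE y0 y x \<rho> \<mu>"
begin

lemma run_local_solution:
  "local_solution M (f i) (g i) (X i) (y i t) (x i t) (\<rho> i t) (\<mu> i t)"
  using run by (simp add: dpd_tv_def)

lemmas run_multiplier = local_solution_multiplier[OF convex_on_f convex_on_g run_local_solution]

lemma run_feasible: "(\<chi> i. x i t) \<in> local_sets X"
  using run_multiplier(1) by (simp add: local_sets_def)

text \<open>Summing the local constraints cancels the allocations \<open>y i t\<close> and leaves
  the total relaxation.\<close>

lemma run_coupling:
  assumes "(\<Sum>i\<in>UNIV. y i t) = 0"
  shows "coupling g (\<chi> i. x i t) \<le> (\<Sum>i\<in>UNIV. \<rho> i t) *\<^sub>R 1"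
proof -
  have "coupling g (\<chi> i. x i t) \<le> (\<Sum>i\<in>UNIV. y i t + \<rho> i t *\<^sub>R 1)"
    unfolding coupling_def by (intro sum_mono) (simp add: run_multiplier(3))
  also have "\<dots> = (\<Sum>i\<in>UNIV. \<rho> i t) *\<^sub>R 1"
    using assms by (simp add: sum.distrib scaleR_sum_left)
  finally show ?thesis .
qed

lemma run_total_cost:
  "(\<Sum>i\<in>UNIV. f i (x i t) + M * \<rho> i t) = total_cost f (\<chi> i. x i t) + M * (\<Sum>i\<in>UNIV. \<rho> i t)"
  by (simp add: total_cost_def sum.distrib sum_distrib_left)

lemma run_cost_ge:
  assumes "(\<Sum>i\<in>UNIV. y i t) = 0"
  shows "opt_cost \<le> (\<Sum>i\<in>UNIV. f i (x i t) + M * \<rho> i t)"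
proof -
  have "0 \<le> (M - norm_1 m) * (\<Sum>i\<in>UNIV. \<rho> i t)"
    using M run_multiplier(2) by (intro mult_nonneg_nonneg sum_nonneg) auto
  then show ?thesis
    using penalty_lower_bound[OF run_feasible run_coupling[OF assms]]
    unfolding run_total_cost by linarith
qed

text \<open>The summed subgradient inequalities against a competitor that respects the allocation
  \<open>v\<close> with relaxation 0. For an optimal \<open>z\<close> this bounds the cost gap by
  its linearisation in \<open>y\<close>.\<close>

lemma run_cost_le:
  assumes z: "z \<in> local_sets X" and v: "\<And>i. g i (z $ i) \<le> v i"
  shows "(\<Sum>i\<in>UNIV. f i (x i t) + M * \<rho> i t)
    \<le> total_cost f z - (\<Sum>i\<in>UNIV. \<mu> i t \<bullet> (y i t - v i))"
proof -
  have "f i (x i t) + M * \<rho> i t \<le> f i (z $ i) - \<mu> i t \<bullet> (y i t - v i)" for i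
    using run_multiplier(5)[of "z $ i" i 0 "v i" t] z v[of i]
    by (simp add: local_sets_def inner_diff_right)
  then show ?thesis
    unfolding total_cost_def sum_subtractf[symmetric] by (rule sum_mono)
qed

text \<open>The local optimal values are Lipschitz in \<open>y\<close> with constant
  \<open>M\<close>, and one update moves each \<open>y i\<close> by at most
  \<open>\<alpha> t\<close> times \<open>2 * M\<close> per neighbour. One factor
  \<open>CARD('n)\<close> bounds the neighbours, the other counts the agents.\<close>

lemma run_cost_step:
  assumes \<alpha>: "0 \<le> \<alpha> t"
  shows "\<bar>(\<Sum>i\<in>UNIV. f i (x i (Suc t)) + M * \<rho> i (Suc t))
    - (\<Sum>i\<in>UNIV. f i (x i t) + M * \<rho> i t)\<bar> \<le> (real CARD('n))\<^sup>2 * 2 * M\<^sup>2 * \<alpha> t"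
proof -
  let ?c = "\<lambda>i t. f i (x i t) + M * \<rho> i t"
  have "\<bar>?c i (Suc t) - ?c i t\<bar> \<le> real CARD('n) * 2 * M\<^sup>2 * \<alpha> t" for i
  proof -
    have "norm (\<Sum>j\<in>{j. (i, j) \<in> EE t}. \<mu> i t - \<mu> j t)
        \<le> (\<Sum>j\<in>{j. (i, j) \<in> EE t}. 2 * M)"
    proof (rule sum_norm_le)
      fix j
      show "norm (\<mu> i t - \<mu> j t) \<le> 2 * M"
        using norm_triangle_ineq4[of "\<mu> i t" "\<mu> j t"] run_multiplier(4)[of i t]
          run_multiplier(4)[of j t] by linarith
    qed
    also have "\<dots> \<le> real CARD('n) * (2 * M)"
      using M_pos card_mono[of UNIV "{j. (i, j) \<in> EE t}"] by (simp add: mult_right_mono)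
    finally have "norm (\<alpha> t *\<^sub>R (\<Sum>j\<in>{j. (i, j) \<in> EE t}. \<mu> i t - \<mu> j t))
        \<le> \<alpha> t * (real CARD('n) * (2 * M))"
      using \<alpha> by (simp add: mult_left_mono)
    moreover have "y i (Suc t) - y i t = \<alpha> t *\<^sub>R (\<Sum>j\<in>{j. (i, j) \<in> EE t}. \<mu> i t - \<mu> j t)"
      using run by (simp add: dpd_tv_def)
    ultimately have dy: "norm (y i (Suc t) - y i t) \<le> \<alpha> t * (real CARD('n) * (2 * M))" by simp
    have inner: "\<bar>\<mu> i s \<bullet> (y i (Suc t) - y i t)\<bar> \<le> real CARD('n) * 2 * M\<^sup>2 * \<alpha> t" for s
    proof -
      have "\<bar>\<mu> i s \<bullet> (y i (Suc t) - y i t)\<bar> \<le> norm (\<mu> i s) * norm (y i (Suc t) - y i t)"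
        by (rule Cauchy_Schwarz_ineq2)
      also have "\<dots> \<le> M * (\<alpha> t * (real CARD('n) * (2 * M)))"
        using dy run_multiplier(4) M_pos by (intro mult_mono) auto
      finally show ?thesis by (simp add: power2_eq_square mult_ac)
    qed
    \<comment> \<open>The solution of time \<open>Suc t\<close> competes in the inequality of time
      \<open>t\<close>, and conversely; together they bound the change from both sides.\<close>
    have "?c i t - \<mu> i t \<bullet> (y i (Suc t) - y i t) \<le> ?c i (Suc t)"
      by (rule run_multiplier(5)[OF run_multiplier(1-3)])
    moreover have "?c i (Suc t) - \<mu> i (Suc t) \<bullet> (y i t - y i (Suc t)) \<le> ?c i t"
      by (rule run_multiplier(5)[OF run_multiplier(1-3)])
    ultimately show ?thesis
      using inner[of t] inner[of "Suc t"] by (simp add: inner_diff_right)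
  qed
  then have "(\<Sum>i\<in>UNIV. \<bar>?c i (Suc t) - ?c i t\<bar>)
      \<le> (\<Sum>i\<in>(UNIV :: 'n set). real CARD('n) * 2 * M\<^sup>2 * \<alpha> t)"
    by (rule sum_mono)
  moreover have "\<bar>\<Sum>i\<in>UNIV. ?c i (Suc t) - ?c i t\<bar> \<le> (\<Sum>i\<in>UNIV. \<bar>?c i (Suc t) - ?c i t\<bar>)"
    by (rule sum_abs)
  ultimately show ?thesis
    by (simp add: sum_subtractf power2_eq_square mult_ac)
qed

end

end

theorem mainTheorem1:
  fixes J :: "'n::{finite,linorder} \<Rightarrow> 'd::finite set"
    and X :: "'n \<Rightarrow> (real ^ 'd) set"
    and f :: "'n \<Rightarrow> real ^ 'd \<Rightarrow> real"
    and g :: "'n \<Rightarrow> real ^ 'd \<Rightarrow> real ^ 's::finite"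
    and xs :: "'n \<Rightarrow> real ^ 'd"
    and \<mu>\<^sub>o\<^sub>p\<^sub>t :: "real ^ 's"
    and M :: real
    and P :: "'w measure"
    and E :: "('n \<times> 'n) set"
    and \<sigma> :: "'n \<Rightarrow> 'n \<Rightarrow> real"
    and \<nu> :: "'n \<Rightarrow> 'n \<Rightarrow> nat \<Rightarrow> 'w \<Rightarrow> bool"
    and \<alpha> :: "nat \<Rightarrow> real"
    and y0 :: "'n \<Rightarrow> real ^ 's"
    and y :: "'n \<Rightarrow> nat \<Rightarrow> 'w \<Rightarrow> real ^ 's"
    and x :: "'n \<Rightarrow> nat \<Rightarrow> 'w \<Rightarrow> real ^ 'd"
    and \<rho> :: "'n \<Rightarrow> nat \<Rightarrow> 'w \<Rightarrow> real"
    and \<mu> :: "'n \<Rightarrow> nat \<Rightarrow> 'w \<Rightarrow> real ^ 's"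
  assumes X: "\<And>i. X i \<subseteq> coord_space (J i) \<and> X i \<noteq> {} \<and> convex (X i) \<and> compact (X i)"
    and f: "\<And>i. convex_on (coord_space (J i)) (f i)"
    and g: "\<And>i s. convex_on (coord_space (J i)) (\<lambda>x. g i x $ s)"
    and slater: "\<And>i. xs i \<in> X i" "\<And>s. (\<Sum>i\<in>UNIV. g i (xs i)) $ s < 0"
    and multiplier: "optimal_multiplier (total_cost f) (local_sets X) (coupling g) \<mu>\<^sub>o\<^sub>p\<^sub>t"
    and M: "M > norm_1 \<mu>\<^sub>o\<^sub>p\<^sub>t"
    and graph: "undirected_connected E"
    and prob: "prob_space P"
    and activation: "random_activation P E \<sigma> \<nu>"
    and causal: "nonanticipating P E \<nu> \<mu>"
    and step_nonneg: "\<And>t. \<alpha> t \<ge> 0"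
    and step_diverges: "filterlim (\<lambda>n. \<Sum>t<n. \<alpha> t) at_top sequentially"
    and step_square: "summable (\<lambda>t. (\<alpha> t)\<^sup>2)"
    and init: "(\<Sum>i\<in>UNIV. y0 i) = 0"
    and run: "\<And>\<omega>. \<omega> \<in> space P \<Longrightarrow>
      dpd_tv M f g X \<alpha> (active_edges E \<nu> \<omega>) y0
        (\<lambda>i t. y i t \<omega>) (\<lambda>i t. x i t \<omega>) (\<lambda>i t. \<rho> i t \<omega>) (\<lambda>i t. \<mu> i t \<omega>)"
  shows "AE \<omega> in P.
      ((\<lambda>t. \<Sum>i\<in>UNIV. (f i (x i t \<omega>) + M * \<rho> i t \<omega>))
         \<longlonglongrightarrow> optimal_cost (total_cost f) (local_sets X) (coupling g)) \<and>
      (\<forall>l. limit_point (\<lambda>t. \<chi> i. x i t \<omega>) l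
         \<longrightarrow> optimal_solution (total_cost f) (local_sets X) (coupling g) l)"
proof -
  interpret constraint_coupled_problem J X f g xs \<mu>\<^sub>o\<^sub>p\<^sub>t M
    by unfold_locales (fact X f g slater multiplier M)+
  obtain xo where xo: "optimal_solution (total_cost f) (local_sets X) (coupling g) xo"
    using optimal_solution_exists by blast
  then have xoX: "xo \<in> local_sets X" and xoG: "coupling g xo \<le> 0"
    by (auto simp: optimal_solution_def is_arg_min_def feasible_def)
  \<comment> \<open>The slack of the coupling constraint at \<open>xo\<close> is shared evenly, so
    that the allocation \<open>v\<close> sums to zero and still admits \<open>xo\<close> without
    relaxation.\<close>
  define v where "v = (\<lambda>i. g i (xo $ i) - (1 / real CARD('n)) *\<^sub>R coupling g xo)"
  have v_ge: "g i (xo $ i) \<le> v i" for i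
    using xoG by (simp add: v_def less_eq_vec_def divide_nonpos_pos)
  have "(\<Sum>i\<in>UNIV. v i - y0 i) = coupling g xo
      - real CARD('n) *\<^sub>R (1 / real CARD('n)) *\<^sub>R coupling g xo"
    unfolding v_def sum_subtractf init sum_constant_scaleR by (simp add: coupling_def)
  then have "(\<Sum>i\<in>UNIV. v i - y0 i) = 0" by simp
  \<comment> \<open>\<open>zs\<close> is a flow carrying \<open>y0\<close> to \<open>v\<close>; it
    is the target from which the Lyapunov function measures distance.\<close>
  from flow_exists[OF graph this] obtain zs where zs: "\<And>w. (\<Sum>i\<in>UNIV. w i \<bullet> (v i - y0 i))
      = (\<Sum>e\<in>up_edges E. (w (fst e) - w (snd e)) \<bullet> zs e)" by blast
  \<comment> \<open>\<open>b\<close> is the gap linearised at the current multipliers, in flow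
    variables; \<open>a\<close>, defined next, is the gap itself.\<close>
  define b where "b = (\<lambda>t \<omega>. - (\<Sum>e\<in>up_edges E. (edge_flow \<alpha> \<nu> \<mu> t \<omega> e - zs e)
    \<bullet> (\<mu> (fst e) t \<omega> - \<mu> (snd e) t \<omega>)))"
  define a where "a = (\<lambda>t \<omega>. (\<Sum>i\<in>UNIV. f i (x i t \<omega>) + M * \<rho> i t \<omega>) - opt_cost)"
  have weak: "(\<Sum>i\<in>UNIV. w i \<bullet> y i t \<omega>) = (\<Sum>i\<in>UNIV. w i \<bullet> y0 i)
      + (\<Sum>e\<in>up_edges E. (w (fst e) - w (snd e)) \<bullet> edge_flow \<alpha> \<nu> \<mu> t \<omega> e)"
    if "\<omega> \<in> space P" for w t \<omega>
    by (rule dpd_tv_weak_form[where \<mu> = \<mu> and \<nu> = \<nu> and \<omega> = \<omega> and y = "\<lambda>i t. y i t \<omega>"])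
      (rule run[OF that])
  have y_sum: "(\<Sum>i\<in>UNIV. y i t \<omega>) = 0" if "\<omega> \<in> space P" for \<omega> t
  proof -
    let ?s = "\<Sum>i\<in>UNIV. y i t \<omega>"
    \<comment> \<open>Testing with the constant vector \<open>?s\<close> kills all edge differences,
      so \<open>?s \<bullet> ?s\<close> equals its value at time 0, which vanishes by
      \<open>init\<close>.\<close>
    have "?s \<bullet> ?s = (\<Sum>i\<in>UNIV. ?s \<bullet> y0 i)"
      using weak[OF that, of "\<lambda>_. ?s" t] by (simp add: inner_sum_right)
    then show ?thesis by (simp add: init flip: inner_sum_right)
  qed
  have a_nonneg: "0 \<le> a t \<omega>" if "\<omega> \<in> space P" for t \<omega>
    using run_cost_ge[OF run[OF that] y_sum[OF that]] by (simp add: a_def)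
  have a_le_b: "a t \<omega> \<le> b t \<omega>" if "\<omega> \<in> space P" for t \<omega>
  proof -
    \<comment> \<open>The multipliers as test vectors convert the pairing with \<open>y - v\<close>
      into the pairing of the flow error with multiplier differences.\<close>
    have "(\<Sum>i\<in>UNIV. \<mu> i t \<omega> \<bullet> (y i t \<omega> - v i)) = (\<Sum>i\<in>UNIV. \<mu> i t \<omega> \<bullet> y i t \<omega>)
        - (\<Sum>i\<in>UNIV. \<mu> i t \<omega> \<bullet> y0 i) - (\<Sum>i\<in>UNIV. \<mu> i t \<omega> \<bullet> (v i - y0 i))"
      by (simp add: inner_diff_right sum_subtractf)
    also have "\<dots> = - b t \<omega>"
      unfolding weak[OF that] zs b_def
      by (simp add: inner_diff_left inner_diff_right inner_commute algebra_simps flip: sum_subtractf)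
    finally show ?thesis
      using run_cost_le[OF run[OF that] xoX v_ge, of t] optimal_cost_eq[OF xo]
      by (simp add: a_def)
  qed
  have "AE \<omega> in P. summable (\<lambda>t. \<alpha> t * b t \<omega>)"
    unfolding b_def
  proof (rule AE_summable_edge_flow_drift[OF prob activation causal step_nonneg step_square])
    show "norm (\<mu> i t \<omega>) \<le> M" if "\<omega> \<in> space P" for i t \<omega>
      by (rule run_multiplier(4)[OF run[OF that]])
    show "0 \<le> - (\<Sum>e\<in>up_edges E. (edge_flow \<alpha> \<nu> \<mu> t \<omega> e - zs e)
        \<bullet> (\<mu> (fst e) t \<omega> - \<mu> (snd e) t \<omega>))" if "\<omega> \<in> space P" for t \<omega>
      using a_nonneg[OF that, of t] a_le_b[OF that, of t] by (simp add: b_def)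
  qed
  with AE_space show ?thesis
  proof eventually_elim
    case (elim \<omega>)
    note \<omega> = elim(1) and run = run[OF elim(1)]
    \<comment> \<open>The gap inherits weighted summability from \<open>b\<close>, which dominates
      it; the step bound needed for convergence is available for \<open>a\<close>.\<close>
    have "summable (\<lambda>t. \<alpha> t * a t \<omega>)"
      by (rule summable_comparison_test'[OF elim(2)])
        (use a_nonneg[OF \<omega>] a_le_b[OF \<omega>] step_nonneg in \<open>auto simp: abs_mult intro: mult_left_mono\<close>)
    moreover have "\<bar>a (Suc t) \<omega> - a t \<omega>\<bar> \<le> (real CARD('n))\<^sup>2 * 2 * M\<^sup>2 * \<alpha> t" for t
      using run_cost_step[OF run step_nonneg, of t] by (simp add: a_def)
    ultimately have "(\<lambda>t. a t \<omega>) \<longlonglongrightarrow> 0"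
      by (intro tendsto_0_if_weighted_summable[OF a_nonneg[OF \<omega>] step_nonneg step_diverges
            step_square])
    then have "(\<lambda>t. a t \<omega> + opt_cost) \<longlonglongrightarrow> 0 + opt_cost" by (intro tendsto_intros)
    then have cost: "(\<lambda>t. \<Sum>i\<in>UNIV. f i (x i t \<omega>) + M * \<rho> i t \<omega>) \<longlonglongrightarrow> opt_cost"
      by (simp add: a_def)
    moreover have "optimal_solution (total_cost f) (local_sets X) (coupling g) l"
      if "limit_point (\<lambda>t. \<chi> i. x i t \<omega>) l" for l
    proof (rule limit_point_optimal[OF run_feasible[OF run] _ run_coupling[OF run y_sum[OF \<omega>]] _ that])
      \<comment> \<open>The total relaxation of all agents takes the place of \<open>r\<close> in
        \<open>limit_point_optimal\<close>.\<close>
      show "0 \<le> (\<Sum>i\<in>UNIV. \<rho> i t \<omega>)" for t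
        by (intro sum_nonneg run_multiplier(2)[OF run])
      show "(\<lambda>t. total_cost f (\<chi> i. x i t \<omega>) + M * (\<Sum>i\<in>UNIV. \<rho> i t \<omega>)) \<longlonglongrightarrow> opt_cost"
        using cost unfolding run_total_cost[OF run] .
    qed
    ultimately show ?case by blast
  qed
qed

end
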